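(* For each $n \in \{22, 30, 31, 34, 35, 36, 40, 41\}$ there exists a $(2,4)$-regular matchstick graph with exactly $n$ vertices which has exactly two vertices of degree 2.
   Context: A matchstick graph is a finite graph drawn in the Euclidean plane such that vertices are distinct points, every edge is a straight line segment of length 1 between its endpoints, and edges do not cross or overlap (two edges intersect at most in a common endpoint). A matchstick graph is $(2,4)$-regular if every vertex has degree 2 or 4. *)

theory Defs
  imports "HOL-Analysis.Analysis"
begin

definition matchstick_graph :: "complex set \<Rightarrow> complex set set \<Rightarrow> bool" where
  "matchstick_graph V E \<longleftrightarrow>
     finite V \<and>
     (\<forall>e\<in>E. \<exists>a b. e = {a, b} \<and> a \<in> V \<and> b \<in> V \<and> dist a b = 1) \<and>
     (\<forall>a b c d. {a, b} \<in> E \<longrightarrow> {c, d} \<in> E \<longrightarrow> {a, b} \<noteq> {c, d} \<longrightarrow>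
        closed_segment a b \<inter> closed_segment c d \<subseteq> {a, b} \<inter> {c, d})"

definition degree :: "complex set set \<Rightarrow> complex \<Rightarrow> nat" where
  "degree E v = card {e \<in> E. v \<in> e}"

definition regular_2_4 :: "complex set \<Rightarrow> complex set set \<Rightarrow> bool" where
  "regular_2_4 V E \<longleftrightarrow> (\<forall>v\<in>V. degree E v = 2 \<or> degree E v = 4)"

end

theory Submission
  imports Defs
begin

text \<open>
  Each of the graphs is the union of a matchstick graph in the closed upper half plane and its
  mirror image. The half meets the real axis in two or three vertices of degree 2, which get degree 4
  in the union, and has exactly one more vertex of degree 2; so only that vertex and its mirror image
  keep degree 2.

  The half graph with \<open>N\<close> vertices, \<open>m\<close> of them on the axis, has \<open>2 N - m - 1\<close> edges, as many as
  there are free coordinates once one axis vertex is put at the origin. The coordinates are algebraic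
  of high degree in general, so they are not written down. Instead, an approximate solution \<open>x\<close> of the edge
  equations \<open>F x = 0\<close> is given together with an approximate right inverse \<open>A\<close> of the Jacobian, and
  \<open>z \<mapsto> z - F (x + A z)\<close> maps a small cube to itself. Brouwer's theorem yields an exact solution so
  close to \<open>x\<close> that planarity can be read off from \<open>x\<close> by integer arithmetic. Edges with a common
  endpoint need no check: two different unit segments starting at one point meet only there.
\<close>

section \<open>Doubling a graph at the real axis\<close>

text \<open>The definition speaks of an edge through all its endpoint pairs. Since every edge is a
  doubleton, planarity can be stated for the edges as sets, with \<open>convex hull e\<close> as the
  drawn segment. In this form the image of an edge under conjugation needs no choice of
  endpoints.\<close>

lemma matchstick_graph_iff:
  "matchstick_graph V E \<longleftrightarrow>
     finite V \<and> (\<forall>e\<in>E. \<exists>a b. e = {a, b} \<and> a \<in> V \<and> b \<in> V \<and> dist a b = 1) \<and>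
     (\<forall>e\<in>E. \<forall>f\<in>E. e \<noteq> f \<longrightarrow> convex hull e \<inter> convex hull f \<subseteq> e \<inter> f)"
proof -
  have "(\<forall>a b c d. {a, b} \<in> E \<longrightarrow> {c, d} \<in> E \<longrightarrow> {a, b} \<noteq> {c, d} \<longrightarrow>
          convex hull {a, b} \<inter> convex hull {c, d} \<subseteq> {a, b} \<inter> {c, d}) \<longleftrightarrow>
        (\<forall>e\<in>E. \<forall>f\<in>E. e \<noteq> f \<longrightarrow> convex hull e \<inter> convex hull f \<subseteq> e \<inter> f)"
    if doubleton: "\<And>e. e \<in> E \<Longrightarrow> \<exists>a b. e = {a, b} \<and> a \<in> V \<and> b \<in> V \<and> dist a b = 1"
  proof (intro iffI ballI impI)
    fix e f
    assume *: "\<forall>a b c d. {a, b} \<in> E \<longrightarrow> {c, d} \<in> E \<longrightarrow> {a, b} \<noteq> {c, d} \<longrightarrow>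
          convex hull {a, b} \<inter> convex hull {c, d} \<subseteq> {a, b} \<inter> {c, d}"
      and ef: "e \<in> E" "f \<in> E" "e \<noteq> f"
    obtain a b c d where "e = {a, b}" "f = {c, d}"
      using doubleton[OF ef(1)] doubleton[OF ef(2)] by auto
    then show "convex hull e \<inter> convex hull f \<subseteq> e \<inter> f"
      using * ef by simp
  qed simp
  then show ?thesis
    unfolding matchstick_graph_def segment_convex_hull by meson
qed

text \<open>On the segment \<open>Im z\<close> is a convex combination of two nonnegative numbers.
  If it vanishes, both terms vanish; an end off the axis then has weight 0, so \<open>z\<close> is
  the other end.\<close>

lemma closed_segment_on_real_axis:
  assumes "z \<in> closed_segment a b" "0 \<le> Im a" "0 \<le> Im b" "Im a \<noteq> 0 \<or> Im b \<noteq> 0" "Im z = 0"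
  shows "z \<in> {a, b}"
proof -
  obtain u where u: "0 \<le> u" "u \<le> 1" "z = (1 - u) *\<^sub>R a + u *\<^sub>R b"
    using assms(1) by (auto simp: in_segment)
  have eq: "(1 - u) * Im a + u * Im b = 0"
    using u(3) assms(5) by simp
  have "0 \<le> (1 - u) * Im a" "0 \<le> u * Im b"
    using u assms by simp_all
  with eq have "(1 - u) * Im a = 0" "u * Im b = 0"
    by linarith+
  with assms(4) have "u = 0 \<or> u = 1"
    by auto
  then show ?thesis using u(3) by auto
qed

lemma convex_hull_cnj: "convex hull (cnj ` e) = cnj ` (convex hull e)"
  using convex_hull_linear_image[of cnj e] by (simp add: bounded_linear.linear bounded_linear_cnj)

text \<open>\<open>off_axis\<close> rules out edges inside the axis. Such an edge would be its own
  mirror image, so doubling would not double its contribution to degrees, and it would meet the axis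
  in more than its endpoints.\<close>

locale upper_half_graph =
  fixes W :: "complex set" and F :: "complex set set"
  assumes matchstick: "matchstick_graph W F"
    and upper: "v \<in> W \<Longrightarrow> 0 \<le> Im v"
    and off_axis: "e \<in> F \<Longrightarrow> \<exists>v\<in>e. Im v \<noteq> 0"
begin

lemma finite_W: "finite W"
  using matchstick by (simp add: matchstick_graph_def)

lemma edgeE:
  assumes "e \<in> F"
  obtains a b where "e = {a, b}" "a \<in> W" "b \<in> W" "dist a b = 1"
  using matchstick assms unfolding matchstick_graph_iff by meson

lemma finite_F: "finite F"
  by (rule finite_subset[of _ "Pow W"]) (auto elim: edgeE simp: finite_W)

lemma edge_subset: "e \<in> F \<Longrightarrow> e \<subseteq> W"
  by (auto elim: edgeE)

lemma hull_upper:
  assumes "e \<in> F" "z \<in> convex hull e"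
  shows "0 \<le> Im z"
proof -
  have "e \<subseteq> {z. Im z \<ge> 0}"
    using edge_subset[OF assms(1)] upper by blast
  then have "convex hull e \<subseteq> {z. Im z \<ge> 0}"
    by (rule hull_minimal) (rule convex_halfspace_Im_ge)
  then show ?thesis using assms(2) by auto
qed

lemma hull_real:
  assumes "e \<in> F" "z \<in> convex hull e" "Im z = 0"
  shows "z \<in> e"
proof -
  obtain a b where ab: "e = {a, b}" "a \<in> W" "b \<in> W"
    using assms(1) by (auto elim: edgeE)
  show ?thesis
    using closed_segment_on_real_axis[of z a b] assms upper off_axis[OF assms(1)]
    by (auto simp: ab segment_convex_hull)
qed

definition "V = W \<union> cnj ` W"
definition "E = F \<union> (`) cnj ` F"

text \<open>An endpoint off the axis lies strictly above it, so the mirrored edge has an endpoint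
  strictly below it, where \<open>W\<close> has no vertices. Hence the two halves of
  \<open>E\<close> share no edge.\<close>

lemma cnj_edge_notin: "e \<in> F \<Longrightarrow> cnj ` e \<notin> F"
proof
  assume e: "e \<in> F" "cnj ` e \<in> F"
  obtain v where v: "v \<in> e" "Im v \<noteq> 0"
    using off_axis[OF e(1)] by auto
  then have "v \<in> W" "cnj v \<in> W"
    using edge_subset[OF e(1)] edge_subset[OF e(2)] by auto
  then show False
    using upper[of v] upper[of "cnj v"] v(2) by simp
qed

text \<open>A common point lies in both closed half planes, hence on the axis, where
  \<open>hull_real\<close> leaves only endpoints of either edge.\<close>

lemma hulls_mixed:
  assumes "e \<in> F" "f \<in> F"
  shows "convex hull e \<inter> convex hull (cnj ` f) \<subseteq> e \<inter> cnj ` f"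
proof
  fix z assume z: "z \<in> convex hull e \<inter> convex hull (cnj ` f)"
  then have zc: "cnj z \<in> convex hull f"
    by (auto simp: convex_hull_cnj)
  have "0 \<le> Im z" "0 \<le> Im (cnj z)"
    using z zc assms hull_upper by blast+
  then have im: "Im z = 0"
    by simp
  then have "z \<in> e" "cnj z \<in> f"
    using z zc assms hull_real by auto
  then show "z \<in> e \<inter> cnj ` f"
    by (metis IntI complex_cnj_cnj imageI)
qed

lemma matchstick_graph_double: "matchstick_graph V E"
  unfolding matchstick_graph_iff
proof (intro conjI ballI impI)
  show "finite V"
    by (simp add: V_def finite_W)
next
  fix e assume "e \<in> E"
  then consider "e \<in> F" | f where "f \<in> F" "e = cnj ` f"
    by (auto simp: E_def)
  then show "\<exists>a b. e = {a, b} \<and> a \<in> V \<and> b \<in> V \<and> dist a b = 1"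
  proof cases
    case 1
    then show ?thesis by (elim edgeE) (auto simp: V_def)
  next
    case 2
    then obtain a b where "f = {a, b}" "a \<in> W" "b \<in> W" "dist a b = 1"
      by (auto elim: edgeE)
    then show ?thesis
      using 2 by (intro exI[of _ "cnj a"] exI[of _ "cnj b"])
        (auto simp: V_def dist_norm complex_mod_cnj simp flip: complex_cnj_diff)
  qed
next
  fix e f assume *: "e \<in> E" "f \<in> E" "e \<noteq> f"
  have planar: "convex hull e \<inter> convex hull f \<subseteq> e \<inter> f" if "e \<in> F" "f \<in> F" "e \<noteq> f" for e f
    using matchstick that unfolding matchstick_graph_iff by blast
  \<comment> \<open>Only the mixed cases are new. Two edges of the lower half are conjugates of
    edges of \<open>F\<close> and inherit planarity, as conjugation is injective.\<close>
  consider "e \<in> F" "f \<in> F" | f' where "e \<in> F" "f' \<in> F" "f = cnj ` f'"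
    | e' where "e' \<in> F" "e = cnj ` e'" "f \<in> F"
    | e' f' where "e' \<in> F" "e = cnj ` e'" "f' \<in> F" "f = cnj ` f'"
    using * unfolding E_def by blast
  then show "convex hull e \<inter> convex hull f \<subseteq> e \<inter> f"
  proof cases
    case 1
    then show ?thesis using planar * by blast
  next
    case 2
    then show ?thesis using hulls_mixed by blast
  next
    case 3
    then show ?thesis using hulls_mixed by blast
  next
    case 4
    have "cnj ` (convex hull e') \<inter> cnj ` (convex hull f') = cnj ` (convex hull e' \<inter> convex hull f')"
      by (auto simp: image_iff)
    also have "\<dots> \<subseteq> cnj ` (e' \<inter> f')"
      using 4 * by (intro image_mono planar) auto
    finally show ?thesis
      using 4 by (auto simp: convex_hull_cnj)
  qed
qed

text \<open>The edges of \<open>E\<close> at \<open>v\<close> are the edges of \<open>F\<close> at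
  \<open>v\<close> and the conjugates of the edges of \<open>F\<close> at \<open>cnj v\<close>. On
  the axis \<open>cnj v = v\<close>, so both families have the same size; off the axis
  \<open>cnj v\<close> lies below it and the second family is empty.\<close>

lemma degree_double:
  assumes "v \<in> W"
  shows "degree E v = (if Im v = 0 then 2 * degree F v else degree F v)"
proof -
  have split: "{e \<in> E. v \<in> e} = {e \<in> F. v \<in> e} \<union> (`) cnj ` {e \<in> F. cnj v \<in> e}"
    by (force simp: E_def image_iff)
  have "inj ((`) cnj)"
    by (metis complex_cnj_cancel_iff injI inj_image_eq_iff)
  then have card_cnj: "card ((`) cnj ` {e \<in> F. cnj v \<in> e}) = card {e \<in> F. cnj v \<in> e}"
    by (meson card_image inj_on_subset subset_UNIV)
  have "card {e \<in> E. v \<in> e} = card {e \<in> F. v \<in> e} + card {e \<in> F. cnj v \<in> e}"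
    unfolding split
    by (subst card_Un_disjoint) (use finite_F cnj_edge_notin in \<open>auto simp: card_cnj\<close>)
  moreover have "cnj v = v" if "Im v = 0"
    using that by (simp add: complex_eq_iff)
  moreover have "card {e \<in> F. cnj v \<in> e} = 0" if "Im v \<noteq> 0"
  proof -
    have "{e \<in> F. cnj v \<in> e} = {}"
      using edge_subset upper[of v] upper[of "cnj v"] assms that by force
    then show ?thesis by (simp only: card.empty)
  qed
  ultimately show ?thesis
    by (cases "Im v = 0") (simp_all add: degree_def)
qed

text \<open>Conjugation is an involution of \<open>E\<close> that exchanges the edges at
  \<open>v\<close> with those at \<open>cnj v\<close>.\<close>

lemma degree_double_cnj: "degree E (cnj v) = degree E v"
proof -
  have cnj_E: "cnj ` e \<in> E" if "e \<in> E" for e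
    using that by (auto simp: E_def image_image)
  have "bij_betw ((`) cnj) {e \<in> E. v \<in> e} {e \<in> E. cnj v \<in> e}"
    by (rule bij_betw_byWitness[where f' = "(`) cnj"]) (auto simp: image_image cnj_E intro: rev_image_eqI)
  then show ?thesis
    unfolding degree_def by (metis bij_betw_same_card)
qed

text \<open>Inclusion and exclusion: \<open>W\<close> and its mirror image share exactly the
  vertices on the axis.\<close>

lemma card_V: "card V = 2 * card W - card {v \<in> W. Im v = 0}"
proof -
  have "W \<inter> cnj ` W = {v \<in> W. Im v = 0}"
  proof (intro equalityI subsetI)
    fix v assume "v \<in> W \<inter> cnj ` W"
    then show "v \<in> {v \<in> W. Im v = 0}"
      using upper[of v] upper[of "cnj v"] by auto
  next
    fix v assume "v \<in> {v \<in> W. Im v = 0}"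
    then show "v \<in> W \<inter> cnj ` W"
      by (auto simp: image_iff complex_eq_iff intro!: bexI[of _ v])
  qed
  moreover have "card (cnj ` W) = card W"
    by (simp add: card_image inj_on_def)
  ultimately show ?thesis
    using card_Un_Int[OF finite_W finite_imageI[OF finite_W, of cnj]] by (simp add: V_def)
qed

lemma double_has_two_terminals:
  assumes t: "t \<in> W" "Im t \<noteq> 0" "degree F t = 2"
    and axis: "\<And>v. v \<in> W \<Longrightarrow> Im v = 0 \<Longrightarrow> degree F v = 2"
    and inner: "\<And>v. v \<in> W \<Longrightarrow> Im v \<noteq> 0 \<Longrightarrow> v \<noteq> t \<Longrightarrow> degree F v = 4"
  shows "matchstick_graph V E \<and> regular_2_4 V E \<and>
         card V = 2 * card W - card {v \<in> W. Im v = 0} \<and> card {v \<in> V. degree E v = 2} = 2"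
proof (intro conjI matchstick_graph_double card_V)
  have deg: "degree E v = (if v = t then 2 else 4)" if "v \<in> W" for v
    using degree_double[OF that] t axis[OF that] inner[OF that] by auto
  show "regular_2_4 V E"
    unfolding regular_2_4_def V_def ball_Un by (simp add: degree_double_cnj deg)
  have "degree E v = 2 \<longleftrightarrow> v = t" if "v \<in> W" for v
    using deg[OF that] by simp
  then have "{v \<in> V. degree E v = 2} = {t, cnj t}"
    using t by (auto simp: V_def degree_double_cnj)
  moreover have "t \<noteq> cnj t"
    using t(2) by (simp add: complex_eq_iff)
  ultimately show "card {v \<in> V. degree E v = 2} = 2"
    by simp
qed

end

section \<open>Solving quadratic systems with Brouwer's theorem\<close>

lemma abs_sum_mult_le:
  fixes f t :: "nat \<Rightarrow> real"
  assumes "\<And>j. j < n \<Longrightarrow> \<bar>t j\<bar> \<le> 1"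
  shows "\<bar>\<Sum>j<n. f j * t j\<bar> \<le> (\<Sum>j<n. \<bar>f j\<bar>)"
proof -
  have "\<bar>\<Sum>j<n. f j * t j\<bar> \<le> (\<Sum>j<n. \<bar>f j * t j\<bar>)"
    by (rule sum_abs)
  also have "\<dots> \<le> (\<Sum>j<n. \<bar>f j\<bar>)"
    using assms by (intro sum_mono) (simp add: abs_mult mult_left_le)
  finally show ?thesis .
qed

text \<open>Divided by \<open>K\<close>, the equations say that \<open>t\<close> is a fixed point of
  the quadratic map with constant part \<open>c\<close>, linear part \<open>L\<close> and squares of
  \<open>P\<close> and \<open>Q\<close>. The bound says that this map sends the cube
  \<open>[-1, 1]\<close> in dimension \<open>n\<close> to itself. The type \<open>'n\<close> only
  supplies the Euclidean space \<open>real ^ 'n\<close> in which Brouwer's theorem is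
  applied.\<close>

lemma quadratic_system_solvable:
  fixes c :: "nat \<Rightarrow> real" and L P Q :: "nat \<Rightarrow> nat \<Rightarrow> real" and K :: real
  assumes card: "CARD('n::finite) = n" and K: "K > 0"
    and bound: "\<And>e. e < n \<Longrightarrow>
      \<bar>c e\<bar> + (\<Sum>j<n. \<bar>L e j\<bar>) + (\<Sum>j<n. \<bar>P e j\<bar>)\<^sup>2 + (\<Sum>j<n. \<bar>Q e j\<bar>)\<^sup>2 \<le> K"
  obtains t where "\<And>j. j < n \<Longrightarrow> \<bar>t j\<bar> \<le> 1"
    and "\<And>e. e < n \<Longrightarrow>
      c e + (\<Sum>j<n. L e j * t j) - (\<Sum>j<n. P e j * t j)\<^sup>2 - (\<Sum>j<n. Q e j * t j)\<^sup>2 = K * t e"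
proof -
  \<comment> \<open>\<open>h\<close> numbers the coordinates of \<open>real ^ 'n\<close> by
    \<open>0, ..., n - 1\<close>, and \<open>g\<close> is its inverse.\<close>
  obtain h where h: "bij_betw h (UNIV :: 'n set) {..<n}"
    using ex_bij_betw_finite_nat[of "UNIV :: 'n set"] card by (auto simp: atLeast0LessThan)
  define g where "g = inv_into UNIV h"
  have hg: "h (g j) = j" if "j < n" for j
    using h that unfolding g_def by (simp add: bij_betw_inv_into_right)
  have h_less: "h i < n" for i
    using h by (auto simp: bij_betw_def)
  define F where "F e t = c e + (\<Sum>j<n. L e j * t j) - (\<Sum>j<n. P e j * t j)\<^sup>2
    - (\<Sum>j<n. Q e j * t j)\<^sup>2" for e and t :: "nat \<Rightarrow> real"
  define T where "T z = (\<chi> i. F (h i) (\<lambda>j. z $ g j) / K)" for z :: "real ^ 'n"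
  let ?B = "cbox (-1) (1 :: real ^ 'n)"
  have box: "z \<in> ?B \<longleftrightarrow> (\<forall>i. \<bar>z $ i\<bar> \<le> 1)" for z
    by (auto simp: mem_box_cart abs_le_iff minus_le_iff)
  have F_le: "\<bar>F e t\<bar> \<le> K" if "e < n" "\<And>j. j < n \<Longrightarrow> \<bar>t j\<bar> \<le> 1" for e t
  proof -
    have "(\<Sum>j<n. P e j * t j)\<^sup>2 \<le> (\<Sum>j<n. \<bar>P e j\<bar>)\<^sup>2" "(\<Sum>j<n. Q e j * t j)\<^sup>2 \<le> (\<Sum>j<n. \<bar>Q e j\<bar>)\<^sup>2"
      using abs_sum_mult_le[of n t "P e"] abs_sum_mult_le[of n t "Q e"] that(2)
      by (metis abs_ge_zero power2_abs power_mono)+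
    moreover have "\<bar>\<Sum>j<n. L e j * t j\<bar> \<le> (\<Sum>j<n. \<bar>L e j\<bar>)"
      using that(2) by (rule abs_sum_mult_le)
    moreover have "0 \<le> (\<Sum>j<n. P e j * t j)\<^sup>2" "0 \<le> (\<Sum>j<n. Q e j * t j)\<^sup>2"
      by simp_all
    ultimately show ?thesis
      using bound[OF that(1)] unfolding F_def by linarith
  qed
  obtain z where z: "z \<in> ?B" "T z = z"
  proof (rule brouwer[of ?B T])
    show "compact ?B" "convex ?B"
      by (simp_all add: compact_cbox convex_box)
    show "?B \<noteq> {}"
      using box[of 0] by auto
    show "continuous_on ?B T"
      unfolding T_def F_def by (intro continuous_on_vec_lambda continuous_intros) (use K in simp_all)
    show "T \<in> ?B \<rightarrow> ?B"
    proof
      fix z assume "z \<in> ?B"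
      then have "\<bar>F (h i) (\<lambda>j. z $ g j)\<bar> \<le> K" for i
        using box h_less F_le by simp
      then show "T z \<in> ?B"
        using K unfolding box T_def by simp
    qed
  qed
  show thesis
  proof
    show "\<bar>z $ g j\<bar> \<le> 1" for j
      using z(1) box by blast
    show "c e + (\<Sum>j<n. L e j * z $ g j) - (\<Sum>j<n. P e j * z $ g j)\<^sup>2 - (\<Sum>j<n. Q e j * z $ g j)\<^sup>2
      = K * z $ g e" if "e < n" for e
    proof -
      have "z $ g e = F e (\<lambda>j. z $ g j) / K"
        using z(2) hg[OF that] unfolding T_def by (metis vec_lambda_beta)
      then show ?thesis
        using K by (simp add: F_def field_simps)
    qed
  qed
qed

section \<open>Planarity from approximate coordinates\<close>

text \<open>Positions are in units of \<open>1 / 100000\<close>, with an error of at most 400 units. So coordinates of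
  difference vectors are off by at most 800, and a product \<open>x * y\<close> of two of them is off by at most
  \<open>800 * (\<bar>x\<bar> + \<bar>y\<bar>) + 640000\<close>.\<close>

definition near :: "complex \<Rightarrow> int \<times> int \<Rightarrow> bool" where
  "near z A \<longleftrightarrow> \<bar>100000 * Re z - fst A\<bar> \<le> 400 \<and> \<bar>100000 * Im z - snd A\<bar> \<le> 400"

fun left_of :: "int \<times> int \<Rightarrow> int \<times> int \<Rightarrow> int \<times> int \<Rightarrow> bool" where
  "left_of (x, y) (x', y') (x'', y'') \<longleftrightarrow>
     800 * (\<bar>x' - x\<bar> + \<bar>y' - y\<bar> + \<bar>x'' - x\<bar> + \<bar>y'' - y\<bar>) + 1280000
       < (x' - x) * (y'' - y) - (y' - y) * (x'' - x)"

text \<open>The second alternative reverses the line through \<open>A\<close> and \<open>B\<close>,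
  so it expresses that \<open>C\<close> and \<open>D\<close> both lie to its right.\<close>

definition same_side :: "int \<times> int \<Rightarrow> int \<times> int \<Rightarrow> int \<times> int \<Rightarrow> int \<times> int \<Rightarrow> bool" where
  "same_side A B C D \<longleftrightarrow> left_of A B C \<and> left_of A B D \<or> left_of B A C \<and> left_of B A D"

text \<open>The gap of 800 absorbs an error of 400 on either side, so an axis-parallel line still
  separates the exact segments.\<close>

fun box_before :: "int \<times> int \<Rightarrow> int \<times> int \<Rightarrow> int \<times> int \<Rightarrow> int \<times> int \<Rightarrow> bool" where
  "box_before (x, y) (x', y') (u, v) (u', v') \<longleftrightarrow>
     max x x' + 800 < min u u' \<or> max y y' + 800 < min v v'"

text \<open>Two segments cross if the ends of each lie strictly on different sides of the line
  through the other. So for disjoint segments in general position one of the two lines leaves the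
  other segment on one side. The box tests are a further option where the cross products are too
  small for the error margin, as for nearly collinear points.\<close>

definition apart :: "int \<times> int \<Rightarrow> int \<times> int \<Rightarrow> int \<times> int \<Rightarrow> int \<times> int \<Rightarrow> bool" where
  "apart A B C D \<longleftrightarrow>
     same_side A B C D \<or> same_side C D A B \<or> box_before A B C D \<or> box_before C D A B"

section \<open>Separating segments whose endpoints are known approximately\<close>

lemma closed_segments_separated:
  fixes a b c d w :: "'a::euclidean_space"
  assumes "w \<bullet> a \<le> r" "w \<bullet> b \<le> r" "r < w \<bullet> c" "r < w \<bullet> d"
  shows "closed_segment a b \<inter> closed_segment c d = {}"
proof -
  have "closed_segment a b \<subseteq> {z. w \<bullet> z \<le> r}"
    using assms by (intro closed_segment_subset convex_halfspace_le) auto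
  moreover have "closed_segment c d \<subseteq> {z. w \<bullet> z > r}"
    using assms by (intro closed_segment_subset convex_halfspace_gt) auto
  ultimately show ?thesis by force
qed

lemma abs_mult_diff_le:
  fixes u v x y d :: real
  assumes "\<bar>u - x\<bar> \<le> d" "\<bar>v - y\<bar> \<le> d"
  shows "\<bar>u * v - x * y\<bar> \<le> d * (\<bar>x\<bar> + \<bar>y\<bar>) + d\<^sup>2"
proof -
  have "u * v - x * y = (u - x) * (v - y) + (u - x) * y + x * (v - y)"
    by (simp add: algebra_simps)
  also have "\<bar>\<dots>\<bar> \<le> \<bar>u - x\<bar> * \<bar>v - y\<bar> + \<bar>u - x\<bar> * \<bar>y\<bar> + \<bar>x\<bar> * \<bar>v - y\<bar>"
    unfolding abs_mult[symmetric] by linarith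
  also have "\<dots> \<le> d * d + d * \<bar>y\<bar> + \<bar>x\<bar> * d"
    using assms by (intro add_mono mult_mono) auto
  finally show ?thesis
    by (simp add: power2_eq_square algebra_simps)
qed

lemma cross_product_pos:
  fixes u v u' v' x y x' y' :: real
  assumes "\<bar>u - x\<bar> \<le> 800" "\<bar>v' - y'\<bar> \<le> 800" "\<bar>v - y\<bar> \<le> 800" "\<bar>u' - x'\<bar> \<le> 800"
    and "800 * (\<bar>x\<bar> + \<bar>y\<bar> + \<bar>x'\<bar> + \<bar>y'\<bar>) + 1280000 < x * y' - y * x'"
  shows "0 < u * v' - v * u'"
proof -
  \<comment> \<open>With the products abstracted to \<open>U\<close>, \<open>V\<close>,
    \<open>X\<close>, \<open>Y\<close> the claim is linear: the two error bounds add up to the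
    margin.\<close>
  have sum: "0 < U - V" if "\<bar>U - X\<bar> \<le> 800 * (p + q) + 640000" "\<bar>V - Y\<bar> \<le> 800 * (r + s) + 640000"
    "800 * (p + r + s + q) + 1280000 < X - Y" for U V X Y p q r s :: real
    using abs_le_D2[OF that(1)] abs_le_D1[OF that(2)] that(3) by (simp add: algebra_simps)
  show ?thesis
    by (rule sum[OF _ _ assms(5)])
      (use abs_mult_diff_le[OF assms(1,2)] abs_mult_diff_le[OF assms(3,4)] in simp_all)
qed

text \<open>The conclusion is the orientation of the exact triangle: \<open>c\<close> lies strictly
  to the left of the directed line from \<open>a\<close> to \<open>b\<close>. The integer test
  leaves room for the errors of all three points.\<close>

lemma left_of_imp:
  assumes "near a A" "near b B" "near c C" "left_of A B C"
  shows "Re (b - a) * Im (c - a) - Im (b - a) * Re (c - a) > 0"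
proof -
  obtain x y x' y' x'' y'' where A: "A = (x, y)" and B: "B = (x', y')" and C: "C = (x'', y'')"
    by (metis surj_pair)
  let ?S = "100000 :: real"
  have "\<bar>?S * Re a - x\<bar> \<le> 400" "\<bar>?S * Im a - y\<bar> \<le> 400" "\<bar>?S * Re b - x'\<bar> \<le> 400"
    "\<bar>?S * Im b - y'\<bar> \<le> 400" "\<bar>?S * Re c - x''\<bar> \<le> 400" "\<bar>?S * Im c - y''\<bar> \<le> 400"
    using assms(1-3) by (simp_all add: near_def A B C)
  then have ba: "\<bar>?S * (Re b - Re a) - real_of_int (x' - x)\<bar> \<le> 800"
      "\<bar>?S * (Im b - Im a) - real_of_int (y' - y)\<bar> \<le> 800"
    and ca: "\<bar>?S * (Re c - Re a) - real_of_int (x'' - x)\<bar> \<le> 800"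
      "\<bar>?S * (Im c - Im a) - real_of_int (y'' - y)\<bar> \<le> 800"
    unfolding of_int_diff right_diff_distrib by linarith+
  have "real_of_int (800 * (\<bar>x' - x\<bar> + \<bar>y' - y\<bar> + \<bar>x'' - x\<bar> + \<bar>y'' - y\<bar>) + 1280000)
      < real_of_int ((x' - x) * (y'' - y) - (y' - y) * (x'' - x))"
    using assms(4) unfolding A B C left_of.simps of_int_less_iff .
  then have "800 * (\<bar>real_of_int (x' - x)\<bar> + \<bar>real_of_int (y' - y)\<bar> + \<bar>real_of_int (x'' - x)\<bar>
        + \<bar>real_of_int (y'' - y)\<bar>) + 1280000
      < real_of_int (x' - x) * real_of_int (y'' - y) - real_of_int (y' - y) * real_of_int (x'' - x)"
    by simp
  note cross_product_pos[OF ba(1) ca(2) ba(2) ca(1) this]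
  \<comment> \<open>Passing to units of \<open>1 / 100000\<close> multiplies the cross product by
    the positive factor \<open>?S\<^sup>2\<close>, which keeps its sign.\<close>
  also have "?S * (Re b - Re a) * (?S * (Im c - Im a)) - ?S * (Im b - Im a) * (?S * (Re c - Re a))
      = ?S\<^sup>2 * (Re (b - a) * Im (c - a) - Im (b - a) * Re (c - a))"
    by (simp add: power2_eq_square algebra_simps)
  finally show ?thesis
    by (simp add: zero_less_mult_iff)
qed

lemma left_of_imp_disjoint:
  assumes "near a A" "near b B" "near c C" "near d D" "left_of A B C" "left_of A B D"
  shows "closed_segment a b \<inter> closed_segment c d = {}"
proof (rule closed_segments_separated)
  \<comment> \<open>This is \<open>b - a\<close> turned left by a right angle: a normal of the line
    through \<open>a\<close> and \<open>b\<close> pointing to the side of \<open>c\<close> and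
    \<open>d\<close>.\<close>
  let ?w = "Complex (- Im (b - a)) (Re (b - a))"
  show "?w \<bullet> a \<le> ?w \<bullet> a" "?w \<bullet> b \<le> ?w \<bullet> a" "?w \<bullet> a < ?w \<bullet> c" "?w \<bullet> a < ?w \<bullet> d"
    using left_of_imp[OF assms(1-3,5)] left_of_imp[OF assms(1,2,4,6)]
    by (simp_all add: inner_complex_def algebra_simps)
qed

text \<open>The separating line is vertical or horizontal, with normal \<open>1\<close> or
  \<open>\<i>\<close>; the inner product with these is the real or imaginary part.\<close>

lemma box_before_imp_disjoint:
  assumes "near a A" "near b B" "near c C" "near d D" "box_before A B C D"
  shows "closed_segment a b \<inter> closed_segment c d = {}"
proof -
  obtain x y x' y' u v u' v' where eqs: "A = (x, y)" "B = (x', y')" "C = (u, v)" "D = (u', v')"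
    by (metis surj_pair)
  have "max x x' + 800 < min u u' \<or> max y y' + 800 < min v v'"
    using assms(5) by (simp add: eqs)
  then consider "x + 800 < u" "x' + 800 < u" "x + 800 < u'" "x' + 800 < u'"
    | "y + 800 < v" "y' + 800 < v" "y + 800 < v'" "y' + 800 < v'"
    by auto
  moreover have less: "r < s" if "\<bar>100000 * r - of_int i\<bar> \<le> 400" "\<bar>100000 * s - of_int j\<bar> \<le> 400" "i + 800 < j"
    for r s :: real and i j :: int
    using that by linarith
  ultimately show ?thesis
  proof cases
    case 1
    then have "max (Re a) (Re b) < Re c" "max (Re a) (Re b) < Re d"
      using assms(1-4) by (auto simp: near_def eqs intro: less)
    then show ?thesis
      by (intro closed_segments_separated[of 1 _ "max (Re a) (Re b)"]) (auto simp: inner_complex_def)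
  next
    case 2
    then have "max (Im a) (Im b) < Im c" "max (Im a) (Im b) < Im d"
      using assms(1-4) by (auto simp: near_def eqs intro: less)
    then show ?thesis
      by (intro closed_segments_separated[of \<i> _ "max (Im a) (Im b)"]) (auto simp: inner_complex_def)
  qed
qed

lemma apart_imp_disjoint:
  assumes "near a A" "near b B" "near c C" "near d D" "apart A B C D"
  shows "closed_segment a b \<inter> closed_segment c d = {}"
proof -
  have side: "closed_segment a b \<inter> closed_segment c d = {}"
    if "near a A" "near b B" "near c C" "near d D" "same_side A B C D" for a b c d A B C D
    using that(5) left_of_imp_disjoint[OF that(1-4)]
      left_of_imp_disjoint[OF that(2,1,3,4), unfolded closed_segment_commute[of b a]]
    unfolding same_side_def by blast
  show ?thesis
    using assms(5) side[OF assms(1-4)] side[OF assms(3,4,1,2)]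
      box_before_imp_disjoint[OF assms(1-4)] box_before_imp_disjoint[OF assms(3,4,1,2)]
    unfolding apart_def Int_commute[of "closed_segment c d"] by blast
qed

section \<open>Unit segments with a common endpoint\<close>

text \<open>A point \<open>z\<close> on both segments satisfies
  \<open>z - a = s (b - a) = t (c - a)\<close>. Both segments have length 1, so \<open>s\<close> and
  \<open>t\<close> both equal the distance of \<open>z\<close> from \<open>a\<close>, and
  \<open>b \<noteq> c\<close> forces \<open>s = 0\<close>.\<close>

lemma unit_segments_common_end:
  fixes a b c :: "'a::euclidean_space"
  assumes "dist a b = 1" "dist a c = 1" "b \<noteq> c"
  shows "closed_segment a b \<inter> closed_segment a c = {a}"
proof -
  have "z = a" if "z \<in> closed_segment a b" "z \<in> closed_segment a c" for z
  proof -
    obtain s where s: "0 \<le> s" "z = (1 - s) *\<^sub>R a + s *\<^sub>R b"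
      using \<open>z \<in> closed_segment a b\<close> by (auto simp: in_segment)
    obtain t where t: "0 \<le> t" "z = (1 - t) *\<^sub>R a + t *\<^sub>R c"
      using \<open>z \<in> closed_segment a c\<close> by (auto simp: in_segment)
    have sa: "z - a = s *\<^sub>R (b - a)"
      by (simp add: s(2) algebra_simps)
    have ta: "z - a = t *\<^sub>R (c - a)"
      by (simp add: t(2) algebra_simps)
    have "norm (z - a) = s"
      unfolding sa using s(1) assms(1) by (simp add: dist_norm norm_minus_commute)
    moreover have "norm (z - a) = t"
      unfolding ta using t(1) assms(2) by (simp add: dist_norm norm_minus_commute)
    ultimately have "s *\<^sub>R (b - a) = s *\<^sub>R (c - a)"
      by (metis sa ta)
    then have "s = 0"
      using assms(3) by simp
    then show ?thesis using sa by simp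
  qed
  then show ?thesis by auto
qed

lemma unit_segments_sharing_end:
  fixes a b c d :: "'a::euclidean_space"
  assumes "dist a b = 1" "dist c d = 1" "{a, b} \<noteq> {c, d}" "{a, b} \<inter> {c, d} \<noteq> {}"
  shows "closed_segment a b \<inter> closed_segment c d \<subseteq> {a, b} \<inter> {c, d}"
proof -
  consider "c = a" "d \<noteq> b" | "d = a" "c \<noteq> b" | "c = b" "d \<noteq> a" | "d = b" "c \<noteq> a"
    using assms(3,4) by auto
  then show ?thesis
  proof cases
    case 1
    then show ?thesis
      using unit_segments_common_end[of a b d] assms by simp
  next
    case 2
    then show ?thesis
      using unit_segments_common_end[of a b c] assms
      by (simp add: closed_segment_commute[of c] dist_commute[of c])
  next
    case 3
    then show ?thesis
      using unit_segments_common_end[of b a d] assms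
      by (simp add: closed_segment_commute[of a b] dist_commute[of a b])
  next
    case 4
    then show ?thesis
      using unit_segments_common_end[of b a c] assms
      by (simp add: closed_segment_commute[of a b] dist_commute[of a b]
          closed_segment_commute[of c] dist_commute[of c])
  qed
qed

section \<open>Certificates\<close>

text \<open>This is the maximum of \<open>\<bar>\<Sum>j. a\<^sub>j t\<^sub>j\<bar>\<close> over the
  cube \<open>\<bar>t\<^sub>j\<bar> \<le> 1\<close>, so it bounds the displacement that a row can
  cause.\<close>

definition norm1 :: "int list \<Rightarrow> int" where
  "norm1 a = sum_list (map abs a)"

text \<open>The rows \<open>(a, b)\<close> of a vertex at \<open>(x, y)\<close> stand for the exact position
  \<open>(x + (\<Sum>j. a\<^sub>j t\<^sub>j) / 10, y + (\<Sum>j. b\<^sub>j t\<^sub>j) / 10)\<close> with one parameter \<open>t\<^sub>j \<in> [-1, 1]\<close> per edge.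
  The condition on edge \<open>e\<close> bounds the \<open>e\<close>-th component of \<open>t - F (x + A t)\<close> on the cube: constant,
  linear and quadratic part, multiplied by \<open>10\<^sup>8\<close>.\<close>

fun edge_ok :: "nat \<times> (int \<times> int) \<times> (int \<times> int) \<times> (int list \<times> int list) \<times> (int list \<times> int list) \<Rightarrow> bool" where
  "edge_ok (e, (x, y), (x', y'), (a, b), (a', b')) \<longleftrightarrow>
     (let dx = x - x'; dy = y - y'; p = map2 (-) a a'; q = map2 (-) b b'
      in 100 * \<bar>dx\<^sup>2 + dy\<^sup>2 - 10000000000\<bar>
        + sum_list (map (\<lambda>(j, u, v). \<bar>(if j = e then 100000000 else 0) - 20 * (dx * u + dy * v)\<bar>)
            (List.enumerate 0 (zip p q)))
        + (norm1 p)\<^sup>2 + (norm1 q)\<^sup>2 \<le> 100000000)"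

text \<open>The first \<open>m\<close> vertices lie on the real axis, and vertex \<open>m\<close> is the one that keeps degree 2.\<close>

definition certificate ::
  "nat \<Rightarrow> (int \<times> int) list \<Rightarrow> (int list \<times> int list) list \<Rightarrow> (nat \<times> nat) list \<Rightarrow> bool" where
  "certificate m ps ds es \<longleftrightarrow>
     m < length ps \<and> length ds = length ps \<and>
     list_all (\<lambda>(a, b). length a = length es \<and> length b = length es \<and> norm1 a \<le> 4000 \<and> norm1 b \<le> 4000) ds \<and>
     list_all (\<lambda>((x, y), (a, b)). y = 0 \<and> norm1 b = 0) (take m (zip ps ds)) \<and>
     list_all (\<lambda>(x, y). 400 < y) (drop m ps) \<and>
     sorted_wrt (\<lambda>(x, y) (x', y'). 800 < \<bar>x - x'\<bar> \<or> 800 < \<bar>y - y'\<bar>) ps \<and>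
     list_all (\<lambda>(i, j). i < j \<and> m \<le> j \<and> j < length ps) es \<and> distinct es \<and>
     list_all edge_ok (map (\<lambda>(e, i, j). (e, ps ! i, ps ! j, ds ! i, ds ! j)) (List.enumerate 0 es)) \<and>
     sorted_wrt (\<lambda>(i, j) (k, l). i = k \<or> i = l \<or> j = k \<or> j = l \<or>
       apart (ps ! i) (ps ! j) (ps ! k) (ps ! l)) es \<and>
     map (\<lambda>k. length (filter (\<lambda>(i, j). i = k \<or> j = k) es)) [0..<length ps]
       = replicate (Suc m) 2 @ replicate (length ps - Suc m) 4"

section \<open>From a certificate to a matchstick graph\<close>

lemma norm1_eq_sum: "norm1 a = (\<Sum>j<length a. \<bar>a ! j\<bar>)"
  by (simp add: norm1_def sum_list_sum_nth atLeast0LessThan)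

text \<open>Translates the check on lists, which is suited to computation, into the indexed sums
  that occur in the hypothesis of \<open>quadratic_system_solvable\<close>.\<close>

lemma edge_ok_bound:
  assumes "edge_ok (e, (x, y), (x', y'), (a, b), (a', b'))"
    and len: "length a = n" "length b = n" "length a' = n" "length b' = n"
  shows "100 * \<bar>(x - x')\<^sup>2 + (y - y')\<^sup>2 - 10000000000\<bar>
    + (\<Sum>j<n. \<bar>(if j = e then 100000000 else 0)
        - 20 * ((x - x') * (a ! j - a' ! j) + (y - y') * (b ! j - b' ! j))\<bar>)
    + (\<Sum>j<n. \<bar>a ! j - a' ! j\<bar>)\<^sup>2 + (\<Sum>j<n. \<bar>b ! j - b' ! j\<bar>)\<^sup>2 \<le> 100000000"
proof -
  have "norm1 (map2 (-) a a') = (\<Sum>j<n. \<bar>a ! j - a' ! j\<bar>)"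
    "norm1 (map2 (-) b b') = (\<Sum>j<n. \<bar>b ! j - b' ! j\<bar>)"
    by (simp_all add: norm1_eq_sum len)
  moreover have "sum_list (map (\<lambda>(j, u, v). \<bar>(if j = e then 100000000 else 0) - 20 * ((x - x') * u + (y - y') * v)\<bar>)
      (List.enumerate 0 (zip (map2 (-) a a') (map2 (-) b b')))) =
    (\<Sum>j<n. \<bar>(if j = e then 100000000 else 0)
        - 20 * ((x - x') * (a ! j - a' ! j) + (y - y') * (b ! j - b' ! j))\<bar>)"
    by (auto simp: sum_list_sum_nth atLeast0LessThan len nth_enumerate_eq intro!: sum.cong)
  ultimately show ?thesis
    using assms(1) by (simp only: edge_ok.simps Let_def)
qed

text \<open>Pairs are ordered by \<open>i < j\<close> and \<open>p\<close> is injective, so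
  different pairs give different edges. Counting edges at \<open>p k\<close> thus amounts to
  counting list entries that contain \<open>k\<close>.\<close>

lemma degree_index_pairs:
  fixes p :: "nat \<Rightarrow> complex"
  assumes inj: "inj_on p {..<N}" and es: "\<And>i j. (i, j) \<in> set es \<Longrightarrow> i < j \<and> j < N"
    and "distinct es" "k < N"
  shows "degree ((\<lambda>(i, j). {p i, p j}) ` set es) (p k) = length (filter (\<lambda>(i, j). i = k \<or> j = k) es)"
proof -
  let ?f = "\<lambda>(i, j). {p i, p j}"
  have p_eq: "p i = p j \<longleftrightarrow> i = j" if "i < N" "j < N" for i j
    using inj_on_eq_iff[OF inj, of i j] that by simp
  have "inj_on ?f (set es)"
  proof (rule inj_onI)
    fix e f assume ef: "e \<in> set es" "f \<in> set es" "?f e = ?f f"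
    obtain i j k l where [simp]: "e = (i, j)" "f = (k, l)"
      by (metis surj_pair)
    have lt: "i < j" "j < N" "k < l" "l < N"
      using ef es by auto
    then have "i < N" "k < N"
      by linarith+
    with ef(3) lt show "e = f"
      by (auto simp: doubleton_eq_iff p_eq)
  qed
  moreover have "{e \<in> ?f ` set es. p k \<in> e} = ?f ` set (filter (\<lambda>(i, j). i = k \<or> j = k) es)"
  proof -
    have "p k \<in> ?f (i, j) \<longleftrightarrow> i = k \<or> j = k" if "(i, j) \<in> set es" for i j
      using es[OF that] p_eq[of k i] p_eq[of k j] \<open>k < N\<close> by auto
    then show ?thesis by force
  qed
  ultimately have "degree (?f ` set es) (p k) = card (set (filter (\<lambda>(i, j). i = k \<or> j = k) es))"
    unfolding degree_def by (metis (no_types, lifting) card_image filter_is_subset inj_on_subset)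
  then show ?thesis
    by (simp only: distinct_card[OF distinct_filter[OF \<open>distinct es\<close>]])
qed

text \<open>The type \<open>'n\<close> has one element per edge, because the system has one
  parameter and one equation per edge. The \<open>m\<close> axis vertices are shared by both halves,
  hence the order \<open>2 * length ps - m\<close>.\<close>

lemma certificate_imp_graph:
  assumes cert: "certificate m ps ds es" and card: "CARD('n::finite) = length es"
  shows "\<exists>V E. matchstick_graph V E \<and> regular_2_4 V E \<and> card V = 2 * length ps - m \<and>
    card {v \<in> V. degree E v = 2} = 2"
proof -
  define n where "n = length es"
  define N where "N = length ps"
  have m: "m < N" and ds: "length ds = N"
    and rows: "\<And>k. k < N \<Longrightarrow> length (fst (ds ! k)) = n \<and> length (snd (ds ! k)) = n \<and>
      norm1 (fst (ds ! k)) \<le> 4000 \<and> norm1 (snd (ds ! k)) \<le> 4000"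
    using cert by (auto simp: certificate_def N_def n_def list_all_length case_prod_unfold)
  have axis: "snd (ps ! k) = 0 \<and> norm1 (snd (ds ! k)) = 0" if "k < m" for k
    using cert that m ds by (auto simp: certificate_def N_def list_all_length case_prod_unfold)
  have above: "400 < snd (ps ! k)" if "m \<le> k" "k < N" for k
  proof -
    have "list_all (\<lambda>(x, y). 400 < y) (drop m ps)"
      using cert by (simp add: certificate_def)
    moreover have "drop m ps ! (k - m) \<in> set (drop m ps)"
      using that by (intro nth_mem) (simp add: N_def)
    ultimately show ?thesis
      using that by (auto simp: list_all_iff N_def)
  qed
  have distinct_points: "800 < \<bar>fst (ps ! i) - fst (ps ! j)\<bar> \<or> 800 < \<bar>snd (ps ! i) - snd (ps ! j)\<bar>"
    if "i < j" "j < N" for i j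
    using cert that by (auto simp: certificate_def N_def sorted_wrt_iff_nth_less case_prod_unfold)
  have es: "i < j \<and> m \<le> j \<and> j < N" if "(i, j) \<in> set es" for i j
    using cert that by (auto simp: certificate_def N_def list_all_iff)
  have "distinct es"
    using cert by (simp add: certificate_def)
  \<comment> \<open>\<open>sorted_wrt\<close> tests each pair of edges only in list order, so either
    order of the arguments of \<open>apart\<close> may occur.\<close>
  have planar: "i = k \<or> i = l \<or> j = k \<or> j = l \<or> apart (ps ! i) (ps ! j) (ps ! k) (ps ! l) \<or>
      apart (ps ! k) (ps ! l) (ps ! i) (ps ! j)"
    if "(i, j) \<in> set es" "(k, l) \<in> set es" "(i, j) \<noteq> (k, l)" for i j k l
  proof -
    obtain e f where ef: "e < length es" "es ! e = (i, j)" "f < length es" "es ! f = (k, l)"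
      using \<open>(i, j) \<in> set es\<close> \<open>(k, l) \<in> set es\<close> by (auto simp: in_set_conv_nth)
    have "sorted_wrt (\<lambda>(i, j) (k, l). i = k \<or> i = l \<or> j = k \<or> j = l \<or>
       apart (ps ! i) (ps ! j) (ps ! k) (ps ! l)) es"
      using cert by (simp add: certificate_def)
    moreover have "e < f \<or> f < e"
      using ef that(3) by (cases e f rule: linorder_cases) auto
    ultimately show ?thesis
      using ef unfolding sorted_wrt_iff_nth_less by fastforce
  qed
  \<comment> \<open>The bound is \<open>k \<le> m\<close>, not \<open>k < m\<close>: besides the
    \<open>m\<close> axis vertices, vertex \<open>m\<close> has degree 2.\<close>
  have degrees: "length (filter (\<lambda>(i, j). i = k \<or> j = k) es) = (if k \<le> m then 2 else 4)" if "k < N" for k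
  proof -
    have "map (\<lambda>k. length (filter (\<lambda>(i, j). i = k \<or> j = k) es)) [0..<N]
       = replicate (Suc m) 2 @ replicate (N - Suc m) 4"
      using cert by (simp add: certificate_def N_def)
    from arg_cong[OF this, of "\<lambda>xs. xs ! k"] show ?thesis
      using that m by (simp add: nth_append del: replicate_Suc)
  qed

  define x y where "x k = fst (ps ! k)" and "y k = snd (ps ! k)" for k
  define a b where "a k j = fst (ds ! k) ! j" and "b k j = snd (ds ! k) ! j" for k j
  define src tgt where "src e = fst (es ! e)" and "tgt e = snd (es ! e)" for e
  define dx dy where "dx e = x (src e) - x (tgt e)" and "dy e = y (src e) - y (tgt e)" for e
  define P Q where "P e j = a (src e) j - a (tgt e) j" and "Q e j = b (src e) j - b (tgt e) j" for e j
  \<comment> \<open>The equation of edge \<open>e\<close> is 100 times the defect of its squared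
    length. \<open>c\<close> and \<open>L\<close> are the constant and linear parts of
    \<open>100000000 * t e\<close> minus this expression; its quadratic part is the sum of the
    squares of the linear forms \<open>P\<close> and \<open>Q\<close>.\<close>
  define c where "c e = - 100 * ((dx e)\<^sup>2 + (dy e)\<^sup>2 - 10000000000)" for e
  define L where "L e j = (if j = e then 100000000 else 0) - 20 * (dx e * P e j + dy e * Q e j)" for e j
  have endpoints: "src e < tgt e" "m \<le> tgt e" "tgt e < N" "src e < N" if "e < n" for e
    using es[of "src e" "tgt e"] that by (auto simp: src_def tgt_def n_def)
  have bound: "\<bar>c e\<bar> + (\<Sum>j<n. \<bar>L e j\<bar>) + (\<Sum>j<n. \<bar>P e j\<bar>)\<^sup>2 + (\<Sum>j<n. \<bar>Q e j\<bar>)\<^sup>2 \<le> 100000000"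
    if "e < n" for e
  proof -
    have "edge_ok (e, ps ! src e, ps ! tgt e, ds ! src e, ds ! tgt e)"
      using cert that by (auto simp: certificate_def list_all_length n_def nth_enumerate_eq src_def tgt_def
          case_prod_unfold)
    then have ok: "edge_ok (e, (x (src e), y (src e)), (x (tgt e), y (tgt e)),
        (fst (ds ! src e), snd (ds ! src e)), (fst (ds ! tgt e), snd (ds ! tgt e)))"
      by (simp only: x_def y_def prod.collapse)
    have len: "length (fst (ds ! src e)) = n" "length (snd (ds ! src e)) = n"
      "length (fst (ds ! tgt e)) = n" "length (snd (ds ! tgt e)) = n"
      using rows endpoints[OF that] by simp_all
    have "\<bar>c e\<bar> = 100 * \<bar>(dx e)\<^sup>2 + (dy e)\<^sup>2 - 10000000000\<bar>"
      unfolding c_def abs_mult by simp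
    then show ?thesis
      using edge_ok_bound[OF ok len] by (simp only: L_def P_def Q_def dx_def dy_def a_def b_def)
  qed
  obtain t where t: "\<And>j. j < n \<Longrightarrow> \<bar>t j\<bar> \<le> 1"
    and sol: "\<And>e. e < n \<Longrightarrow>
      real_of_int (c e) + (\<Sum>j<n. of_int (L e j) * t j) - (\<Sum>j<n. of_int (P e j) * t j)\<^sup>2
        - (\<Sum>j<n. of_int (Q e j) * t j)\<^sup>2 = 100000000 * t e"
  proof (rule quadratic_system_solvable[where 'n = 'n and c = "\<lambda>e. real_of_int (c e)"
        and L = "\<lambda>e j. of_int (L e j)" and P = "\<lambda>e j. of_int (P e j)" and Q = "\<lambda>e j. of_int (Q e j)"
        and K = 100000000 and n = n])
    show "CARD('n) = n"
      using card by (simp add: n_def)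
    fix e assume "e < n"
    from bound[OF this] have "real_of_int (\<bar>c e\<bar> + (\<Sum>j<n. \<bar>L e j\<bar>) + (\<Sum>j<n. \<bar>P e j\<bar>)\<^sup>2 + (\<Sum>j<n. \<bar>Q e j\<bar>)\<^sup>2)
        \<le> real_of_int 100000000"
      by (rule of_int_le_iff[THEN iffD2])
    then show "\<bar>real_of_int (c e)\<bar> + (\<Sum>j<n. \<bar>real_of_int (L e j)\<bar>)
        + (\<Sum>j<n. \<bar>real_of_int (P e j)\<bar>)\<^sup>2 + (\<Sum>j<n. \<bar>real_of_int (Q e j)\<bar>)\<^sup>2 \<le> 100000000"
      by simp
  qed auto

  define X Y where "X k = x k + (\<Sum>j<n. a k j * t j) / 10" and "Y k = y k + (\<Sum>j<n. b k j * t j) / 10" for k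
  define p where "p k = Complex (X k / 100000) (Y k / 100000)" for k
  have small: "\<bar>\<Sum>j<n. of_int (r ! j) * t j\<bar> \<le> of_int (norm1 r)" if "length r = n" for r :: "int list"
    using abs_sum_mult_le[of n t "\<lambda>j. of_int (r ! j)"] t that by (simp add: norm1_eq_sum)
  \<comment> \<open>Rows are in tenths of a unit, so the bound 4000 on \<open>norm1\<close> is the
    error of 400 units in \<open>near\<close>.\<close>
  have p_near: "near (p k) (ps ! k)" if "k < N" for k
  proof -
    have "\<bar>\<Sum>j<n. of_int (a k j) * t j\<bar> \<le> 4000" "\<bar>\<Sum>j<n. of_int (b k j) * t j\<bar> \<le> 4000"
      using small[of "fst (ds ! k)"] small[of "snd (ds ! k)"] rows[OF that]
      unfolding a_def b_def by linarith+
    moreover have "100000 * Re (p k) - fst (ps ! k) = (\<Sum>j<n. of_int (a k j) * t j) / 10"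
      "100000 * Im (p k) - snd (ps ! k) = (\<Sum>j<n. of_int (b k j) * t j) / 10"
      by (simp_all add: p_def X_def Y_def x_def y_def field_simps)
    ultimately show ?thesis
      unfolding near_def by linarith
  qed
  \<comment> \<open>Axis vertices must lie on the axis exactly, not just nearly. This holds because
    their second rows vanish, so no parameter moves them vertically.\<close>
  have Im_axis: "Im (p k) = 0" if "k < m" for k
    using small[of "snd (ds ! k)"] axis[OF that] rows[of k] that m
    by (simp add: p_def Y_def y_def b_def)
  have Im_above: "0 < Im (p k)" if "m \<le> k" "k < N" for k
  proof -
    have "real_of_int (snd (ps ! k)) > 400"
      using above[OF that] by simp
    then show ?thesis
      using p_near[OF that(2)] unfolding near_def by linarith
  qed
  have inj: "inj_on p {..<N}"
  proof (rule linorder_inj_onI)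
    fix i j assume "i < j" "j \<in> {..<N}"
    then have ij: "i < j" "i < N" "j < N" by simp_all
    have far: "r \<noteq> s" if "\<bar>100000 * r - of_int k\<bar> \<le> 400" "\<bar>100000 * s - of_int l\<bar> \<le> 400" "800 < \<bar>k - l\<bar>"
      for r s :: real and k l :: int
      using that by linarith
    then show "p i \<noteq> p j"
      using distinct_points[OF ij(1,3)] p_near[OF ij(2)] p_near[OF ij(3)] unfolding near_def by metis
  qed auto
  have unit: "dist (p (src e)) (p (tgt e)) = 1" if "e < n" for e
  proof -
    let ?u = "\<Sum>j<n. of_int (P e j) * t j" and ?v = "\<Sum>j<n. of_int (Q e j) * t j"
    have X: "X (src e) - X (tgt e) = of_int (dx e) + ?u / 10"
      by (simp add: X_def dx_def P_def algebra_simps sum_subtractf diff_divide_distrib)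
    have Y: "Y (src e) - Y (tgt e) = of_int (dy e) + ?v / 10"
      by (simp add: Y_def dy_def Q_def algebra_simps sum_subtractf diff_divide_distrib)
    have "(\<Sum>j<n. of_int (L e j) * t j) =
        (\<Sum>j<n. (if j = e then 100000000 * t e else 0)
          - 20 * (of_int (dx e) * (of_int (P e j) * t j) + of_int (dy e) * (of_int (Q e j) * t j)))"
      by (rule sum.cong) (auto simp: L_def algebra_simps)
    also have "\<dots> = 100000000 * t e - 20 * (of_int (dx e) * ?u + of_int (dy e) * ?v)"
      using that by (simp add: sum_subtractf sum.distrib sum_distrib_left[symmetric])
    \<comment> \<open>The term \<open>100000000 * t e\<close> occurs on both sides of the fixed
      point equation and cancels; what remains says that the squared length is exactly
      \<open>100000\<^sup>2\<close>.\<close>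
    finally have "(X (src e) - X (tgt e))\<^sup>2 + (Y (src e) - Y (tgt e))\<^sup>2 = 10000000000"
      using sol[OF that] unfolding X Y c_def by (simp add: power2_eq_square field_simps)
    moreover have "(dist (p (src e)) (p (tgt e)))\<^sup>2
        = ((X (src e) - X (tgt e))\<^sup>2 + (Y (src e) - Y (tgt e))\<^sup>2) / 10000000000"
      by (simp add: dist_norm cmod_power2 p_def diff_divide_distrib[symmetric] power_divide add_divide_distrib)
    ultimately have "(dist (p (src e)) (p (tgt e)))\<^sup>2 = 1"
      by simp
    then show ?thesis
      using power2_eq_1_iff zero_le_dist by (metis le_minus_one_simps(3) order_trans)
  qed
  have unit_edge: "dist (p i) (p j) = 1" if "(i, j) \<in> set es" for i j
    using unit that unfolding src_def tgt_def n_def by (metis fst_conv in_set_conv_nth snd_conv)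

  define W where "W = p ` {..<N}"
  define F where "F = (\<lambda>(i, j). {p i, p j}) ` set es"
  \<comment> \<open>Edges without a common index are separated by the integer test; for the others
    unit length suffices.\<close>
  have segments: "convex hull {p i, p j} \<inter> convex hull {p k, p l} \<subseteq> {p i, p j} \<inter> {p k, p l}"
    if e: "(i, j) \<in> set es" and f: "(k, l) \<in> set es" and neq: "{p i, p j} \<noteq> {p k, p l}" for i j k l
  proof (cases "{i, j} \<inter> {k, l} = {}")
    case True
    have lt: "i < N" "j < N" "k < N" "l < N"
      using es[OF e] es[OF f] by auto
    have "apart (ps ! i) (ps ! j) (ps ! k) (ps ! l) \<or> apart (ps ! k) (ps ! l) (ps ! i) (ps ! j)"
      using planar[OF e f] True by auto
    then have "closed_segment (p i) (p j) \<inter> closed_segment (p k) (p l) = {}"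
      using apart_imp_disjoint[OF lt[THEN p_near]] apart_imp_disjoint[OF lt(3,4,1,2)[THEN p_near]] by blast
    then show ?thesis
      by (simp add: segment_convex_hull)
  next
    case False
    then have "{p i, p j} \<inter> {p k, p l} \<noteq> {}"
      by auto
    then show ?thesis
      using unit_segments_sharing_end[OF unit_edge[OF e] unit_edge[OF f] neq]
      by (simp only: segment_convex_hull not_False_eq_True)
  qed
  have "matchstick_graph W F"
    unfolding matchstick_graph_iff
  proof (intro conjI ballI impI)
    show "finite W"
      by (simp add: W_def)
    show "\<exists>a b. e = {a, b} \<and> a \<in> W \<and> b \<in> W \<and> dist a b = 1" if e: "e \<in> F" for e
    proof -
      obtain i j where "e = {p i, p j}" "(i, j) \<in> set es"
        using e by (auto simp: F_def)
      then show ?thesis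
        using es[of i j] unit_edge[of i j] unfolding W_def
        by (intro exI[of _ "p i"] exI[of _ "p j"]) auto
    qed
    show "convex hull e \<inter> convex hull f \<subseteq> e \<inter> f" if ef: "e \<in> F" "f \<in> F" "e \<noteq> f" for e f
    proof -
      obtain i j k l where "e = {p i, p j}" "(i, j) \<in> set es" "f = {p k, p l}" "(k, l) \<in> set es"
        using ef by (auto simp: F_def)
      then show ?thesis
        using segments[of i j k l] ef(3) by simp
    qed
  qed
  moreover have "0 \<le> Im v" if v: "v \<in> W" for v
  proof -
    obtain k where "v = p k" "k < N"
      using v by (auto simp: W_def)
    then show ?thesis
      using Im_axis[of k] Im_above[of k] by (cases "k < m") auto
  qed
  \<comment> \<open>The larger index \<open>j\<close> of an edge satisfies \<open>m \<le> j\<close>,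
    so that end is strictly above the axis.\<close>
  moreover have "\<exists>v\<in>e. Im v \<noteq> 0" if e: "e \<in> F" for e
  proof -
    obtain i j where "e = {p i, p j}" "(i, j) \<in> set es"
      using e by (auto simp: F_def)
    then show ?thesis
      using es[of i j] Im_above[of j] by auto
  qed
  ultimately interpret upper_half_graph W F
    by unfold_locales
  have degree_p: "degree F (p k) = (if k \<le> m then 2 else 4)" if "k < N" for k
    unfolding F_def using degree_index_pairs[OF inj _ \<open>distinct es\<close> that] es degrees[OF that] by auto
  have Im_p: "Im (p k) = 0 \<longleftrightarrow> k < m" if "k < N" for k
    using Im_axis[of k] Im_above[OF _ that] by (cases "k < m") auto
  have "matchstick_graph V E \<and> regular_2_4 V E \<and>
         card V = 2 * card W - card {v \<in> W. Im v = 0} \<and> card {v \<in> V. degree E v = 2} = 2"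
  proof (rule double_has_two_terminals[of "p m"])
    show "p m \<in> W" "Im (p m) \<noteq> 0" "degree F (p m) = 2"
      using m Im_p[of m] degree_p[of m] by (auto simp: W_def)
  qed (auto simp: W_def Im_p degree_p le_less)
  moreover have "{v \<in> W. Im v = 0} = p ` {..<m}"
    using Im_p m by (auto simp: W_def)
  then have "card {v \<in> W. Im v = 0} = m"
    using inj m by (simp add: card_image inj_on_subset)
  moreover have "card W = N"
    using inj by (simp add: W_def card_image)
  ultimately show ?thesis
    unfolding N_def by metis
qed

section \<open>The eight half graphs\<close>

text \<open>A cycle through the \<open>m + 1\<close> vertices of degree 2 turns a half graph into a 4-regular plane
  graph. The halves were found by enumerating such plane graphs and solving the edge equations
  numerically. The smallest half consists of three equilateral triangles with sides 1, 2, 2, the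
  larger two subdivided, around a triangular hole.\<close>

lemma certificate_22: "certificate 2
    [(0, 0), (297558, 0), (47959, 293668), (33607, 94184), (40783, 193926), (98369, 17987),
     (123574, 137840), (130750, 237583), (155955, 99742), (197964, 8994), (213541, 181497),
     (255550, 90748)]
    [(replicate 21 0, replicate 21 0),
     ([-10, 54, 52, -5, 0, 0, 0, 8, -9, 0, 0, 11, 52, 0, -9, 0, 0, 11, 0, 0, -5], replicate 21 0),
     ([46, 35, 24, -57, 32, -58, 32, -4, 17, 0, 0, 14, 24, 0, 17, -58, 0, 14, 0, 0, -57], [48,
      -16, -4, 9, 48, 4, 48, 8, 8, 0, 0, -12, -4, 0, 8, 4, 0, -12, 0, 0, 9]),
     ([8, 48, 8, -18, 0, 0, 0, -28, -33, 0, 0, 38, 8, 0, -33, 0, 0, 38, 0, 0, -18], [50, -17, -3,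
      6, 0, 0, 0, 10, 12, 0, 0, -13, -3, 0, 12, 0, 0, -13, 0, 0, 6]),
     ([27, 42, 16, -37, 0, 0, 4, -16, 21, -29, -29, 26, 16, 29, -8, -29, 0, 26, 0, 0, -37], [49,
      -17, -3, 8, 0, 0, 50, 9, 8, 2, 2, -13, -3, -2, 10, 2, 0, -13, 0, 0, 8]),
     ([-7, 53, 1, -3, 0, 0, 0, 5, -6, 0, 0, 7, 1, 0, -6, 0, 0, 7, 0, 0, -3], [38, -13, -8, 19, 0,
      0, 0, -28, 34, 0, 0, -39, -8, 0, 34, 0, 0, -39, 0, 0, 19]),
     ([16, 45, 11, -27, 0, 0, -13, -23, 23, 13, -13, 32, 11, 13, -22, -13, 0, 32, 0, 0, -27], [33,
      -11, -10, 24, 0, 0, 26, -1, 11, -26, 26, -3, -10, -26, -11, 26, 0, -3, 0, 0, 24]),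
     ([35, 39, 19, -46, 0, 0, 16, -11, 20, -16, 16, 21, 19, 16, 3, -41, 0, 21, 0, 0, -46], [32,
      -11, -11, 25, 0, 0, 24, -2, 11, -24, 24, -2, -11, 24, -13, 28, 0, -2, 0, 0, 25]),
     ([9, 48, 8, -19, 0, 0, 0, -6, 8, 0, 0, 20, 32, 0, 8, 0, -24, -9, -24, 24, 4], [27, -9, -13,
      30, 0, 0, 0, -20, 24, 0, 0, 13, -29, 0, 24, 0, 17, -28, 17, -17, 14]),
     ([-9, 54, 1, -2, 0, 0, 0, 6, -8, 0, 0, 12, 51, 0, -8, 0, -3, 9, 3, -3, -4], [19, -6, -16, 38,
      0, 0, 0, -14, 17, 0, 0, 9, -21, 0, 17, 0, -29, -20, 29, -29, 10]),
     ([24, 43, 15, -35, 0, 0, 0, -18, 22, 0, 0, 27, 15, 0, 22, 0, 0, 27, 0, 0, -35], [16, -5, -17,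
      41, 0, 0, 0, -12, 14, 0, 0, 8, -17, 0, 14, 0, 0, 8, 0, 0, 41]),
     ([7, 48, 7, -18, 0, 0, 0, -5, 6, 0, 0, 19, 34, 0, 6, 0, -26, -7, 26, 26, 3], [8, -3, -21, 49,
      0, 0, 0, -6, 7, 0, 0, 4, -9, 0, 7, 0, -12, -8, 12, 12, 4])]
    [(0, 3), (0, 5), (1, 9), (1, 11), (2, 4), (2, 7), (3, 4), (3, 5), (3, 6), (4, 6), (4, 7), (5,
     8), (5, 9), (6, 7), (6, 10), (7, 10), (8, 9), (8, 10), (8, 11), (9, 11), (10, 11)]"
  by code_simp

text \<open>Vertex 0 has zero rows and so stays at the origin, which removes horizontal
  translations. The 14 vertices above the axis and the other axis vertex have
  \<open>2 * 14 + 1 = 29\<close> free coordinates, one for each edge.\<close>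

lemma certificate_30: "certificate 2
    [(0, 0), (291637, 0), (48987, 394847), (22464, 97444), (44929, 194888), (46958, 294868),
     (95621, 29267), (118086, 126711), (132528, 243120), (134558, 343100), (147939, 222151),
     (171776, 125034), (195612, 27916), (220128, 291353), (243964, 194235), (267800, 97118)]
    [(replicate 29 0, replicate 29 0),
     ([-17, 56, 56, -16, 0, 0, -10, 7, -7, 0, 8, -9, 0, 0, 13, 56, 5, 0, -9, 0, 4, 10, -7, 11, 7,
      -7, 7, -3, -9], replicate 29 0),
     ([58, 39, 19, -75, 30, -58, 46, -12, 12, 30, -9, 19, 0, 0, 20, 24, 31, 0, 19, -58, -9, 26,
      -8, -1, 8, -8, 8, -59, -67], [46, -11, -2, 9, 49, 1, 52, 6, -6, 49, 5, 8, 0, 0, -7, -5, -12,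
      0, 8, 1, 4, -10, 3, 1, -3, 3, -3, 4, 7]),
     ([2, 52, 5, -19, 0, 0, -23, -41, -15, 0, 18, -21, 0, 0, 44, 10, 28, 0, -21, 0, -9, 23, -6,
      -3, 6, -6, 6, -6, -12], [51, -12, -1, 4, 0, 0, 5, 9, 4, 0, -4, 5, 0, 0, -10, -2, -6, 0, 5,
      0, 2, -5, 1, 1, -1, 1, -1, 1, 3]),
     ([20, 48, 9, -37, 0, 0, -6, -26, 26, 0, -21, -41, 0, 0, 33, 19, 56, 0, -41, 0, -19, 46, -12,
      -6, 12, -12, 12, -12, -25], [47, -11, -2, 9, 0, 0, 53, 6, -6, 0, 5, 9, 0, 0, -8, -4, -13, 0,
      9, 0, 4, -11, 3, 1, -3, 3, -3, 3, 6]),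
     ([39, 43, 14, -56, 0, 0, 20, -19, 19, 1, -15, 18, -29, -29, 26, 22, 43, 29, -11, -29, -14,
      36, -10, -4, 10, -10, 10, -36, -46], [46, -11, -2, 9, 0, 0, 52, 6, -6, 50, 5, 8, 1, 1, -7,
      -5, -13, -1, 9, 1, 4, -10, 3, 1, -3, 3, -3, 3, 6]),
     ([-11, 55, 1, -6, 0, 0, -7, 5, -5, 0, 5, -6, 0, 0, 13, 3, 8, 0, -6, 0, -3, 7, -2, -1, 2, -2,
      2, -2, -4], [37, -9, -5, 18, 0, 0, 22, -15, 15, 0, -17, 20, 0, 0, -44, -9, -28, 0, 20, 0, 9,
      -23, 6, 3, -6, 6, -6, 6, 12]),
     ([7, 51, 6, -24, 0, 0, -29, -36, 36, 0, 23, -27, 0, 0, 41, 13, 36, 0, -27, 0, -12, 30, -8,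
      -4, 8, -8, 8, -8, -16], [33, -8, -6, 22, 0, 0, 27, -5, 5, 0, -21, 25, 0, 0, 1, -12, -34, 0,
      25, 0, 11, -28, 8, 4, -8, 8, -8, 7, 15]),
     ([29, 45, 11, -46, 0, 0, 7, -22, 22, -14, -18, 17, 14, -14, 30, 20, 50, 14, -27, -14, -16,
      41, -11, -5, 11, -11, 11, -23, -35], [30, -7, -6, 25, 0, 0, 30, 0, 0, 25, 0, 7, -25, 25, -2,
      -6, -2, -25, -17, 25, 0, -2, 1, -1, -1, 1, -1, 23, 24]),
     ([48, 41, 16, -65, 0, 0, 33, -15, 15, 15, -12, 18, -15, 15, 23, 23, 37, 15, 3, -43, -11, 31,
      -9, -2, 9, -9, 9, -47, -56], [30, -7, -6, 26, 0, 0, 29, 0, 0, 25, -1, 7, -25, 25, -2, -7,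
      -1, 25, -17, 26, 0, -2, 1, -1, -1, 1, -1, 24, 25]),
     ([25, 46, 10, -42, 0, 0, 12, -13, 13, 0, -10, 11, 0, 0, 23, 30, 35, 0, 11, 0, -36, -13, -23,
      -14, 23, -23, 23, 3, -19], [27, -6, -7, 28, 0, 0, 14, -13, 13, 0, -11, 13, 0, 0, 7, -17, 19,
      0, 13, 0, 19, -15, 12, 7, -12, 12, -12, 4, 16]),
     ([7, 51, 6, -24, 0, 0, 3, -4, 4, 0, -2, 2, 0, 0, 19, 41, 22, 0, 2, 0, -28, -3, 16, -28, -16,
      -40, 40, 1, 17], [23, -5, -8, 33, 0, 0, 12, -11, 11, 0, -9, 11, 0, 0, 6, -14, 16, 0, 11, 0,
      -30, -12, 22, 3, -22, 8, -8, 3, 25]),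
     ([-12, 55, 1, -5, 0, 0, -7, 5, -5, 0, 5, -6, 0, 0, 14, 53, 9, 0, -6, 0, -3, 7, -2, -2, 2, -2,
      2, -2, -4], [18, -4, -9, 37, 0, 0, 10, -9, 9, 0, -7, 9, 0, 0, 5, -11, 13, 0, 9, 0, -24, -10,
      17, -42, -17, 17, -17, 3, 20]),
     ([38, 43, 14, -55, 0, 0, 19, -19, 19, 0, -15, 18, 0, 0, 27, 22, 44, 0, 18, 0, -14, 36, -10,
      -4, 10, -10, 10, -35, -45], [14, -3, -10, 42, 0, 0, 7, -6, 6, 0, -6, 6, 0, 0, 3, -9, 9, 0,
      6, 0, -4, 7, -1, -3, 1, -1, 1, 44, 43]),
     ([20, 48, 9, -37, 0, 0, 10, -10, 10, 0, -8, 9, 0, 0, 22, 33, 31, 0, 9, 0, -45, -10, 28, -18,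
      28, -28, 28, 3, -9], [9, -2, -12, 46, 0, 0, 5, -4, 4, 0, -4, 4, 0, 0, 2, -6, 6, 0, 4, 0,
      -12, -5, 9, -7, 5, -5, 5, 1, 52]),
     ([1, 52, 5, -18, 0, 0, 0, -2, 2, 0, 0, 0, 0, 0, 17, 45, 18, 0, 0, 0, -21, 0, 11, -32, -11,
      11, 45, 0, 11], [5, -1, -13, 51, 0, 0, 2, -2, 2, 0, -2, 2, 0, 0, 1, -3, 3, 0, 2, 0, -6, -2,
      4, -10, -4, 4, 9, 1, 5])]
    [(0, 3), (0, 6), (1, 12), (1, 15), (2, 5), (2, 9), (3, 4), (3, 6), (3, 7), (4, 5), (4, 7), (4,
     8), (5, 8), (5, 9), (6, 7), (6, 12), (7, 10), (8, 9), (8, 13), (9, 13), (10, 11), (10, 13),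
     (10, 14), (11, 12), (11, 14), (11, 15), (12, 15), (13, 14), (14, 15)]"
  by code_simp

text \<open>An odd order \<open>2 * N - m\<close> needs an odd number of axis vertices; here
  \<open>N = 17\<close> and \<open>m = 3\<close>.\<close>

lemma certificate_31: "certificate 3
    [(0, 0), (297617, 0), (425222, 0), (262438, 225751), (42106, 90703), (84212, 181406), (99604,
     8887), (141710, 99590), (163767, 241996), (176462, 142805), (199209, 17773), (256016,
     203395), (263805, 94110), (291283, 109820), (326550, 16245), (354688, 187149), (389955,
     93575)]
    [(replicate 30 0, replicate 30 0),
     ([-5, 52, 54, -11, 0, 0, 0, 0, -5, 0, 0, 11, 1, -10, 0, 52, 11, -1, 1, 0, -10, 7, 1, 0, -1,
      1, 0, 0, 0, 0], replicate 30 0),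
     ([15, 44, 22, -65, 38, 36, 0, 0, 15, 0, 0, -12, 10, 6, 0, 44, -12, -10, 10, 9, -4, 23, -5,
      18, 54, -23, -18, 18, -18, 18], replicate 30 0),
     ([38, 34, 14, -41, 1, -2, 84, 35, 38, 0, 0, -12, 36, -6, 0, 34, -12, -14, -57, 11, -18, 21,
      -24, -35, 17, -19, 6, -6, 6, 4], [20, -9, -2, 6, -11, 31, 200, 214, 20, 0, 0, 4, 26, -16, 0,
      -9, 4, 27, -195, -26, 11, -6, -30, -192, 5, -17, 13, -13, 13, 44]),
     ([13, 45, 6, -18, 0, 0, 0, 0, -8, -26, -26, 18, 1, -16, 26, 19, -8, -1, 1, -1, -17, 12, 1, 0,
      -1, 1, 0, 0, 0, 0], [49, -21, -3, 8, 0, 0, 0, 0, 4, 12, 12, -8, -1, 8, -12, -9, 4, 1, -1, 0,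
      8, -6, 0, 0, 0, 0, 0, 0, 0, 0]),
     ([30, 37, 12, -36, 0, 1, 0, 0, 30, 0, 0, -16, 3, -33, 0, 37, -16, -3, 3, -2, -33, 25, 2, 0,
      -2, 2, 0, 0, 0, 0], [41, -17, -6, 17, 0, 0, 0, 0, 41, 0, 0, 8, -1, 15, 0, -17, 8, 1, -1, 1,
      15, -11, -1, 0, 1, -1, 0, 0, 0, 0]),
     ([-3, 52, 1, -2, 0, 0, 0, 0, -1, 3, -3, 2, 0, -2, 3, 2, -1, 0, 0, 0, -2, 1, 0, 0, 0, 0, 0, 0,
      0, 0], [38, -16, -7, 20, 0, 0, 0, 0, 9, -29, 29, -20, -1, 18, -29, -21, 9, 1, -1, 1, 18,
      -13, -1, 0, 1, -1, 0, 0, 0, 0]),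
     ([14, 44, 7, -20, 0, 0, 0, 0, -9, -24, 24, 20, 1, -18, 24, 21, -9, -1, 1, -1, -18, 13, 1, 0,
      -1, 1, 0, 0, 0, 0], [30, -13, -10, 28, 0, -1, 0, 0, 13, -17, 17, -28, -2, 25, 17, -29, 13,
      2, -2, 1, 26, -19, -2, 0, 1, -1, 0, 0, 0, 0]),
     ([39, 34, 13, -38, 2, -6, 0, 0, 39, 0, 0, -13, 37, -7, 0, 34, -13, -15, -20, 13, -20, 21,
      -16, -3, 13, -13, 3, -3, 3, -3], [29, -12, -7, 20, -3, 8, 0, 0, 29, 0, 0, 3, 36, -19, 0,
      -12, 3, 18, 28, -18, -1, -6, 23, 4, -19, 19, -4, 4, -4, 4]),
     ([25, 40, 12, -34, -2, 5, 0, 0, 25, 0, 0, -18, 17, 8, 0, 40, -18, -17, 17, -11, -41, 27, 14,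
      2, -11, 11, -2, 2, -2, 2], [27, -12, -7, 20, -3, 9, 0, 0, 27, 0, 0, 2, 33, -17, 0, -12, 2,
      -33, 33, -21, -4, -5, 26, 5, -22, 22, -5, 5, -5, 5]),
     ([-2, 51, 1, -3, 0, 0, 0, 0, -2, 0, 0, 4, 0, -3, 0, 51, 4, 0, 0, 0, -3, 2, 0, 0, 0, 0, 0, 0,
      0, 0], [19, -8, -13, 39, 0, -1, 0, 0, 19, 0, 0, -40, -3, 36, 0, -8, -40, 3, -3, 2, 37, -27,
      -2, 0, 2, -2, 0, 0, 0, 0]),
     ([33, 36, 13, -37, 1, -2, 0, 0, 33, 0, 0, -15, 29, -1, 0, 36, -15, -29, 29, 26, -29, 23, -4,
      -1, 4, -4, 1, -1, 1, -1], [16, -7, -8, 24, -6, 18, 0, 0, 16, 0, 0, -3, 17, -6, 0, -7, -3,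
      -17, 17, 14, -21, 0, 50, 9, -42, 41, -9, 9, -9, 9]),
     ([13, 45, 6, -17, 0, -1, 0, 0, 13, 0, 0, -27, -2, 25, 0, 45, -27, 2, -2, 1, 25, 36, -2, 0, 1,
      -1, 0, 0, 0, 0], [6, -3, -17, 51, 0, 0, 0, 0, 6, 0, 0, -14, -1, 12, 0, -3, -14, 1, -1, 1,
      13, 10, -1, 0, 1, -1, 0, 0, 0, 0]),
     ([25, 40, 17, -50, -7, 20, 0, 0, 25, 0, 0, -14, 20, 2, 0, 40, -14, -20, 20, 18, -17, 23, -10,
      37, 27, -38, -37, -17, 17, 37], [12, -5, -6, 19, -9, 26, 0, 0, 12, 0, 0, -2, 13, -4, 0, -5,
      -2, -13, 13, 11, -16, 0, -6, 23, -33, 28, -23, 3, -3, 23]),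
     ([16, 43, 22, -63, -15, 42, 0, 0, 16, 0, 0, -12, 11, 5, 0, 43, -12, -11, 11, 10, -6, 23, -6,
      21, 50, -27, -21, 21, -21, 21], [9, -4, -5, 14, -12, 34, 0, 0, 9, 0, 0, -1, 10, -3, 0, -4,
      -1, -10, 10, 8, -12, 0, -4, 17, -24, -21, -17, 17, -17, 17]),
     ([32, 37, 13, -39, -1, 2, 0, 0, 32, 0, 0, -15, 28, 0, 0, 37, -15, -28, 28, 24, -27, 23, -13,
      50, 8, -10, 4, -4, 4, 6], [7, -3, -3, 10, -14, 41, 0, 0, 7, 0, 0, -1, 7, -2, 0, -3, -1, -7,
      7, 6, -9, 0, -3, 12, -17, 5, 8, -8, 8, 49]),
     ([23, 40, 18, -52, -9, 24, 0, 0, 23, 0, 0, -13, 19, 3, 0, 40, -13, -19, 19, 17, -15, 23, -9,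
      34, 31, -43, -34, 34, 20, 34], [3, -1, -2, 5, -17, 49, 0, 0, 3, 0, 0, -1, 3, -1, 0, -1, -1,
      -3, 3, 3, -4, 0, -2, 6, -9, -8, -6, 6, 14, 6])]
    [(0, 4), (0, 6), (1, 10), (1, 12), (2, 14), (2, 16), (3, 8), (3, 15), (4, 5), (4, 6), (4, 7),
     (5, 7), (5, 8), (5, 9), (6, 7), (6, 10), (7, 10), (8, 9), (8, 11), (9, 11), (9, 12), (10,
     12), (11, 13), (11, 15), (12, 14), (13, 14), (13, 15), (13, 16), (14, 16), (15, 16)]"
  by code_simp

text \<open>The Jacobian is less well conditioned here: the first row of vertex 2 has absolute sum
  3414 of the 4000 allowed, so a tolerance smaller than 341 units would not do.\<close>

lemma certificate_34: "certificate 2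
    [(0, 0), (200000, 0), (25000, 443235), (-75000, 270030), (-73176, 170046), (-71353, 70063),
     (-25000, 356632), (12500, 221617), (14324, 121634), (25000, 96825), (25000, 270030), (75000,
     356632), (100000, 173205), (110676, 148396), (112500, 48412), (125000, 270030), (196353,
     199967), (198176, 99983)]
    [(replicate 33 0, replicate 33 0),
     ([-56, 40, 58, -28, 0, 0, 28, 0, -58, 50, 28, 0, 0, -282, 293, 0, 0, 0, -58, -282, 282, 58,
      0, 50, 0, -40, -293, 0, 282, 0, 0, 56, -28], replicate 33 0),
     ([-24, 132, 2, -112, 50, -50, 82, 50, -80, 44, 82, 0, 0, -375, 352, 0, 0, 0, -80, -375, 432,
      2, 0, 44, -50, -51, -393, 0, 432, 0, 0, 8, -112], [13, 36, 0, 6, 29, 29, 43, 29, -37, 18,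
      43, 0, 0, -115, 94, 0, 0, 0, -37, -115, 116, 0, 0, 18, 29, -5, -135, 0, 116, 0, 0, 43, 6]),
     ([-36, 96, 1, -68, 0, 0, 38, 0, -79, 19, 38, 0, 0, -257, 256, 0, 0, 0, -79, -257, 315, 1, 0,
      19, 0, -15, -297, 0, 315, 0, 0, 21, -68], [20, 57, 0, -19, 0, 0, 68, 0, -38, 32, 68, 0, 0,
      -183, 150, 0, 0, 0, -38, -183, 184, 0, 0, 32, 0, -26, -191, 0, 184, 0, 0, 36, -19]),
     ([-44, 75, 1, -43, 0, 0, 14, 0, -29, 25, 13, -29, -29, -189, 200, 0, 0, 29, -58, -218, 247,
      1, 0, 25, 0, -20, -241, 0, 247, 0, 0, 28, -43], [20, 56, 0, -18, 0, 0, 18, 0, -37, 32, 68,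
      -1, -1, -182, 149, 0, 0, 1, -38, -183, 183, 0, 0, 32, 0, -26, -190, 0, 183, 0, 0, 36, -18]),
     ([-51, 55, 0, -18, 0, 0, 18, 0, -37, 32, 18, 0, 0, -179, 145, 0, 0, 0, -37, -179, 179, 0, 0,
      32, 0, -26, -185, 0, 179, 0, 0, 35, -18], [20, 56, 0, -18, 0, 0, 18, 0, -37, 32, 18, 0, 0,
      -182, 148, 0, 0, 0, -37, -182, 182, 0, 0, 32, 0, -26, -189, 0, 182, 0, 0, 36, -18]),
     ([-30, 114, 2, -90, 0, 0, 60, 25, -80, 56, 60, 0, 0, -316, 304, -25, -25, 0, -80, -316, 374,
      2, 25, 31, -25, -33, -345, 0, 374, 0, 0, 15, -90], [16, 46, 0, -6, 0, 0, 56, 43, -38, 10,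
      56, 0, 0, -149, 122, 14, 14, 0, -38, -149, 150, 0, -14, 25, 14, -16, -163, 0, 150, 0, 0, 39,
      -6]),
     ([-40, 86, 1, -56, 0, 0, 12, 0, -25, 22, 26, 14, -14, -224, 229, 0, 0, 14, -69, -238, 282, 1,
      0, 22, 0, -18, -270, 0, 282, 0, 0, 24, -56], [14, 39, 0, 3, 0, 0, 21, 0, -43, 38, 46, 25,
      -25, -124, 101, 0, 0, 25, -19, -149, 125, 0, 0, 38, 0, -30, -142, 0, 125, 0, 0, 42, 3]),
     ([-47, 66, 1, -31, 0, 0, 16, 0, -33, 28, 1, -15, 15, -156, 174, 0, 0, 15, -48, -199, 214, 1,
      0, 28, 0, -23, -214, 0, 214, 0, 0, 32, -31], [13, 38, 0, 4, 0, 0, 21, 0, -44, 38, 46, 25,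
      -25, -123, 100, 0, 0, -25, -19, -148, 124, 0, 0, 38, 0, -31, -141, 0, 124, 0, 0, 42, 4]),
     ([-49, 60, 1, -24, 0, 0, 24, 0, -51, 44, 24, 0, 0, -247, 256, 0, 0, 0, -51, -247, 247, 1, 0,
      44, 0, -35, -256, 0, 247, 0, 0, 49, -24], [13, 36, 0, 6, 0, 0, -6, 0, 13, -11, -6, 0, 0, 64,
      -66, 0, 0, 0, 13, 64, -64, 0, 0, -11, 0, 9, 66, 0, -64, 0, 0, -13, 6]),
     ([-36, 96, 1, -68, 0, 0, 38, 0, -79, 69, 38, 0, 0, -257, 256, 0, 0, 0, -79, -257, 315, 1, 0,
      19, 0, -15, -297, 0, 315, 0, 0, 21, -68], [13, 36, 0, 6, 0, 0, 43, 29, -37, 18, 43, 0, 0,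
      -115, 94, -29, 29, 0, -37, -115, 116, 0, -29, 18, 29, -5, -135, 0, 116, 0, 0, 43, 6]),
     ([-30, 114, 2, -90, 0, 0, 60, 25, -80, 56, 60, 0, 0, -316, 304, -25, 25, 0, -80, -316, 374,
      2, 25, 31, -25, -33, -345, 0, 374, 0, 0, 15, -90], [9, 26, 0, 19, 0, 0, 31, 14, -37, 25, 31,
      0, 0, -81, 66, -14, 14, 0, -37, -81, 82, 0, 14, 10, 43, 5, -107, 0, 82, 0, 0, 47, 19]),
     ([-43, 76, 1, -44, 0, 0, 14, 0, -29, 25, 14, 0, 0, -191, 202, 0, 0, 0, -29, -191, 249, 1, 0,
      25, 0, -20, -243, 0, 249, 0, 0, 28, -44], [7, 21, -1, 25, 0, 0, 24, 0, -50, 43, 24, 0, 0,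
      -64, 52, 0, 0, 0, -50, -64, 65, -1, 0, 43, 0, -35, -93, 0, 65, 0, 0, 48, 25]),
     ([-45, 71, 1, -37, 0, 0, 23, 0, -47, 40, 23, 0, 0, -228, 237, 0, 0, 0, -47, -228, 271, 16, 0,
      40, 0, -33, -237, -15, 228, -15, 15, 45, -23], [6, 18, -1, 28, 0, 0, -3, 0, 7, -6, -3, 0, 0,
      33, -34, 0, 0, 0, 7, 33, -7, -25, 0, -6, 0, 5, 34, 25, -33, 25, -25, -6, 3]),
     ([-52, 50, 0, -12, 0, 0, 26, 0, -54, 47, 26, 0, 0, -264, 274, 0, 0, 0, -54, -264, 278, 44, 0,
      47, 0, -38, -274, -14, 264, 14, -14, 52, -26], [6, 18, -1, 28, 0, 0, -3, 0, 7, -6, -3, 0, 0,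
      32, -33, 0, 0, 0, 7, 32, -7, -25, 0, -6, 0, 5, 33, -25, -32, 25, -25, -6, 3]),
     ([-36, 96, 1, -68, 0, 0, 38, 0, -79, 69, 38, 0, 0, -257, 256, 0, 0, 0, -79, -257, 315, 1, 0,
      69, 0, -15, -297, 0, 315, 0, 0, 21, -68], [5, 15, -1, 32, 0, 0, 18, 0, -37, 32, 18, 0, 0,
      -47, 38, 0, 0, 0, -37, -47, 48, -1, 0, 32, 0, 15, -80, 0, 48, 0, 0, 50, 32]),
     ([-41, 82, 1, -51, 0, 0, 21, 0, -43, 37, 21, 0, 0, -209, 217, 0, 0, 0, -43, -209, 267, 1, 0,
      37, 0, -30, -217, 0, 267, 0, 0, 41, -51], [0, 1, -1, 50, 0, 0, 0, 0, 0, 0, 0, 0, 0, 1, -1,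
      0, 0, 0, 0, 1, 0, -1, 0, 0, 0, 0, 1, 0, 0, 0, 0, 0, 50]),
     ([-49, 61, 1, -25, 0, 0, 24, 0, -50, 44, 24, 0, 0, -246, 255, 0, 0, 0, -50, -246, 274, 29, 0,
      44, 0, -35, -255, -29, 246, 29, 29, 49, -24], [0, 0, -1, 50, 0, 0, 0, 0, 0, 0, 0, 0, 0, 1,
      -1, 0, 0, 0, 0, 1, 0, -1, 0, 0, 0, 0, 1, -1, -1, 1, 1, 0, 0])]
    [(0, 5), (0, 9), (1, 14), (1, 17), (2, 6), (2, 11), (3, 4), (3, 6), (3, 7), (3, 10), (4, 5),
     (4, 7), (4, 8), (5, 8), (5, 9), (6, 10), (6, 11), (7, 8), (7, 12), (8, 12), (9, 13), (9, 14),
     (10, 11), (10, 15), (11, 15), (12, 15), (12, 16), (13, 14), (13, 16), (13, 17), (14, 17),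
     (15, 16), (16, 17)]"
  by code_simp

text \<open>Again \<open>m = 3\<close>, with \<open>N = 19\<close>. The first row of vertex 2 comes
  even closer to the bound 4000, with absolute sum 3653.\<close>

lemma certificate_35: "certificate 3
    [(0, 0), (185123, 0), (212132, 0), (383750, 344033), (13505, 99084), (27009, 198168), (92561,
     37847), (106066, 259405), (106066, 136931), (119571, 160321), (185123, 320642), (198627,
     221558), (198627, 99084), (212132, 122474), (244908, 240482), (284437, 332338), (291189,
     61237), (304694, 160321), (344222, 252177)]
    [(replicate 34 0, replicate 34 0),
     ([-33, 59, 62, 57, -64, -11, 0, 0, -22, 11, -11, 11, 114, -110, 40, 0, 11, 0, 93, 0, -110,
      -23, 20, 0, -23, 110, -114, -16, 0, 20, 0, 0, 22, 0], replicate 34 0),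
     ([-4, 55, -18, -124, 139, -40, 0, 0, -79, -75, 75, 40, 414, -399, 60, 0, 40, 0, 437, 0, -399,
      -82, 71, 0, -82, 399, -414, -57, 0, 71, 0, 0, 79, 0], replicate 34 0),
     ([28, 50, 38, 260, -291, -50, 53, -7, 20, -8, 8, 72, 158, -193, 38, 0, 72, 0, 148, 0, -193,
      -53, 18, 53, -53, 229, -215, -17, 0, 18, 0, 0, 15, -7], [-2, 0, -42, -290, 324, 55, -23, 57,
      -50, -48, 48, -2, 173, -153, 13, 0, -2, 0, 197, 0, -153, -37, 44, -23, -37, 108, -165, -18,
      0, 44, 0, 0, 95, 57]),
     ([-8, 55, 11, 75, -84, -14, 0, 0, -29, -43, -14, 14, 150, -144, 52, 0, 14, 0, 121, 0, -144,
      -30, 26, 0, -30, 144, -150, -21, 0, 26, 0, 0, 29, 0], [51, -8, -1, -10, 11, 2, 0, 0, 4, 6,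
      2, -2, -20, 20, -7, 0, -2, 0, -17, 0, 20, 4, -3, 0, 4, -20, 20, 3, 0, -3, 0, 0, -4, 0]),
     ([7, 53, 22, 150, -167, -29, 0, 0, -22, -29, 29, 29, 242, -289, 46, 0, 29, 0, 242, 0, -289,
      -59, 51, 0, -59, 289, -300, -41, 0, 51, 0, 0, 57, 0], [50, -7, -3, -20, 23, 4, 0, 0, 53, 4,
      -4, -4, -33, 39, -6, 0, -4, 0, -33, 0, 39, 8, -7, 0, 8, -39, 41, 6, 0, -7, 0, 0, -8, 0]),
     ([-16, 56, 4, 29, -32, -5, 0, 0, -11, 5, -5, 5, 57, -55, 20, 0, 5, 0, 46, 0, -55, -11, 10, 0,
      -11, 55, -57, -8, 0, 10, 0, 0, 11, 0], [40, -6, -10, -70, 78, 13, 0, 0, 27, -13, 13, -13,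
      -140, 135, -48, 0, -13, 0, -113, 0, 135, 28, -24, 0, 28, -135, 140, 19, 0, -24, 0, 0, -27,
      0]),
     ([16, 52, 29, 196, -219, -37, 0, 0, -4, -20, 20, 59, 207, -228, 43, -18, 20, -18, 203, 18,
      -246, -41, 35, 0, -58, 263, -264, -29, 0, 35, 0, 0, 40, 0], [38, -6, -12, -80, 90, 15, 0, 0,
      31, -8, 8, 38, 13, -39, -2, 23, 8, 23, 18, -23, -16, -16, 13, 0, 7, -7, -5, -11, 0, 13, 0,
      0, 15, 0]),
     ([-2, 54, 15, 103, -116, -20, 0, 0, -40, -37, 37, 20, 207, -199, 50, 0, 20, 0, 167, 0, -199,
      -41, 35, 0, -41, 199, -207, -29, 0, 35, 0, 0, 40, 0], [38, -6, -12, -80, 90, 15, 0, 0, 31,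
      -8, 8, -15, -160, 154, -2, 0, -15, 0, -130, 0, 154, 32, -27, 0, 32, -154, 160, 22, 0, -27,
      0, 0, -31, 0]),
     ([1, 54, 18, 121, -135, -23, 0, 0, -33, -34, 34, 45, 264, -269, 48, -11, 34, 11, 267, -11,
      -315, -70, 61, 0, -59, 304, -321, -49, 0, 61, 0, 0, 68, 0], [36, -5, -13, -90, 101, 17, 0,
      0, 27, -9, 9, 36, 20, -44, -1, -27, 9, 27, 27, -27, -26, -20, 17, 0, 7, -1, -13, -14, 0, 17,
      0, 0, 19, 0]),
     ([24, 50, 35, 242, -271, -46, 0, 0, 14, -11, 11, 68, 172, -203, 40, 0, 68, 0, 163, 0, -203,
      -58, 20, 0, -58, 238, -229, -16, 0, 20, 0, 0, 22, 0], [27, -4, -20, -140, 156, 27, 0, 0, 8,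
      -19, 19, 27, 58, -71, 2, 0, 27, 0, 69, 0, -71, 7, 34, 0, 7, 26, -50, -27, 0, 34, 0, 0, 38,
      0]),
     ([10, 53, 24, 167, -187, -32, 0, 0, -15, -25, 25, 54, 229, -244, 45, -29, 25, 29, 227, 29,
      -272, -52, 45, 0, -59, 279, -286, -37, 0, 45, 0, 0, 50, 0], [25, -4, -22, -150, 168, 29, 0,
      0, 4, -21, 21, 25, 66, -77, 3, -4, 21, 4, 78, 4, -81, -43, 37, 0, 6, 31, -58, -30, 0, 37, 0,
      0, 42, 0]),
     ([-18, 57, 22, 152, -148, -25, 0, 0, -50, -32, 32, 25, 264, -255, 50, 0, 25, 0, 265, 0, -255,
      -52, 45, 0, -52, 255, -264, -37, 0, 45, 0, 0, 50, 0], [-2, 0, 5, 38, 11, 2, 0, 0, 4, 6, -6,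
      -2, -20, 20, -1, 0, -2, 0, -23, 0, 20, 4, -3, 0, 4, -20, 20, 3, 0, -3, 0, 0, -4, 0]),
     ([-4, 55, 14, 93, -103, -18, 0, 0, -44, -40, 40, 40, 286, -284, 50, 0, 40, 0, 291, 0, -284,
      -82, 71, 0, -82, 320, -343, -57, 0, 71, 0, 0, 79, 0], [23, -3, -23, -160, 179, 31, 0, 0, 0,
      -23, 23, 23, 74, -83, 4, 0, 23, 0, 86, 0, -83, -47, 41, 0, -47, 37, -66, -33, 0, 41, 0, 0,
      46, 0]),
     ([13, 52, 27, 182, -203, -35, 0, 0, -10, -22, 22, 57, 218, -236, 44, 0, 57, 0, 215, 0, -236,
      -75, 53, 23, -75, 271, -275, -12, -23, 23, -23, 23, 45, 23], [18, -3, -27, -185, 207, 35, 0,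
      0, -9, -28, 28, 18, 93, -96, 6, 0, 18, 0, 108, 0, -96, -6, -3, 17, -6, 50, -85, -24, -17,
      37, -17, 17, 55, 17]),
     ([26, 50, 37, 251, -281, -48, 0, 0, 17, -9, 9, 70, 165, -198, 39, 0, 70, 0, 156, 0, -198,
      -55, 22, 50, -55, 233, -222, -16, -3, 19, 3, -3, 18, -3], [12, -2, -31, -215, 240, 41, 0, 0,
      -21, -33, 33, 12, 116, -112, 8, 0, 12, 0, 133, 0, -112, -15, 10, 6, -15, 67, -108, -22, 29,
      39, -29, 29, 67, 29]),
     ([-13, 56, 7, 46, -52, -9, 0, 0, -61, -48, 48, 31, 321, -310, 54, 0, 31, 0, 331, 0, -310,
      -63, 55, 0, -63, 345, -321, -44, 0, 55, 0, 0, 61, 0], [11, -2, -32, -220, 246, 42, 0, 0,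
      -23, -34, 34, 11, 119, -115, 8, 0, 11, 0, 137, 0, -115, -24, 20, 0, -24, 69, -119, -17, 0,
      20, 0, 0, 23, 0]),
     ([1, 54, 18, 121, -135, -23, 0, 0, -33, -34, 34, 45, 264, -269, 48, 0, 45, 0, 267, 0, -269,
      -93, 80, 0, -93, 304, -321, -8, 0, 80, 0, 0, 68, 0], [9, -1, -34, -230, 257, 44, 0, 0, -27,
      -36, 36, 9, 127, -121, 9, 0, 9, 0, 146, 0, -121, -20, 17, 0, -20, 75, -119, -21, 0, 17, 0,
      0, 72, 0]),
     ([15, 52, 28, 191, -213, -36, 0, 0, -6, -21, 21, 58, 211, -231, 43, 0, 58, 0, 207, 0, -231,
      -73, 49, 27, -73, 266, -268, -12, -27, 23, 27, 27, 42, 20], [4, -1, -38, -260, 291, 50, 0,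
      0, -38, -42, 42, 4, 150, -137, 11, 0, 4, 0, 172, 0, -137, -28, 30, -11, -28, 91, -142, -20,
      11, 42, -11, -11, 84, 46])]
    [(0, 4), (0, 6), (1, 6), (1, 12), (2, 12), (2, 16), (3, 15), (3, 18), (4, 5), (4, 6), (4, 8),
     (5, 7), (5, 8), (5, 9), (6, 8), (7, 9), (7, 10), (7, 11), (8, 12), (9, 11), (9, 13), (10,
     11), (10, 14), (10, 15), (11, 13), (12, 16), (13, 16), (13, 17), (14, 15), (14, 17), (14,
     18), (15, 18), (16, 17), (17, 18)]"
  by code_simp

lemma certificate_36: "certificate 2
    [(0, 0), (392305, 0), (291288, 387021), (33338, 94279), (66676, 188558), (98317, 18268),
     (131655, 112547), (143860, 252141), (160332, 153506), (196634, 36536), (220442, 316446),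
     (237515, 217089), (246138, 219804), (253987, 118455), (271835, 123162), (296254, 27826),
     (316984, 290379), (342681, 193737), (368378, 97095)]
    [(replicate 35 0, replicate 35 0),
     ([-11, 54, 56, -16, 0, 0, -11, 0, 0, 11, -6, -6, 0, 54, 11, 2, -5, -2, -2, -5, 8, 56, 4, -5,
      15, -15, 9, 5, -5, 7, 5, -6, 7, -5, -10], replicate 35 0),
     ([45, 35, 14, -55, 56, -41, 45, 0, 0, -8, 48, -17, 0, 35, -8, 2, 50, -2, -2, -15, 18, 19, 9,
      -4, 18, -18, 13, 4, -4, -3, 4, -6, 7, -45, -49], [15, -5, -10, 41, 15, 41, 15, 0, 0, -5, 14,
      -3, 0, -5, -5, 0, 14, 0, 0, -3, 3, -10, 1, 0, 2, -1, 1, 0, 0, -2, 0, 0, -1, 41, 41]),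
     ([3, 50, 3, -13, 0, 0, -14, -27, -27, 19, -5, -14, 27, 23, -8, 1, -4, -1, -1, -12, 14, 9, 4,
      -4, 12, -12, 8, 4, -4, -4, 4, -5, 6, -4, -8], [52, -18, -1, 5, 0, 0, 5, 10, 10, -7, 2, 5,
      -10, -8, 3, 0, 1, 0, 0, 4, -5, -3, -1, 1, -4, 4, -3, -1, 1, 1, -1, 2, -2, 1, 3]),
     ([17, 45, 7, -27, 0, 0, 17, 0, 0, -17, -10, -27, 0, 45, -17, 3, -8, -3, -3, -25, 28, 18, 7,
      -8, 24, -25, 15, 8, -8, -8, 8, -11, 11, -8, -16], [47, -16, -2, 9, 0, 0, 47, 0, 0, 6, 4, 10,
      0, -16, 6, -1, 3, 1, 1, 9, -10, -6, -3, 3, -9, 9, -5, -3, 3, 3, -3, 4, -4, 3, 6]),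
     ([-8, 54, 1, -3, 0, 0, -3, 5, -5, 4, -1, -3, 5, 4, -2, 0, -1, 0, 0, -2, 3, 2, 1, -1, 2, -2,
      1, 1, -1, -1, 1, -1, 1, -1, -2], [43, -14, -3, 14, 0, 0, 14, -28, 28, -20, 5, 14, -28, -24,
      9, -1, 4, 1, 1, 13, -14, -9, -4, 4, -13, 13, -8, -4, 4, 4, -4, 6, -6, 4, 8]),
     ([6, 49, 4, -16, 0, 0, -16, -22, 22, 22, -6, -16, 22, 27, -10, 2, -5, -2, -2, -15, 16, 11, 4,
      -5, 14, -15, 9, 5, -5, -5, 5, -6, 7, -5, -10], [38, -13, -5, 19, 0, 0, 19, -19, 19, -26, 7,
      19, 19, -32, 12, -2, 5, 2, 2, 17, -19, -12, -5, 6, -17, 17, -11, -6, 6, 6, -6, 7, -8, 6,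
      11]),
     ([26, 42, 9, -36, 0, 0, 26, 0, 0, -9, 25, -5, 0, 42, -9, -15, -10, -22, 15, -20, 20, 24, 10,
      -11, 14, -33, 20, 11, -11, -11, 11, -14, 15, -11, -21], [36, -12, -5, 20, 0, 0, 36, 0, 0,
      -3, 40, -18, 0, -12, -3, 20, 6, 24, -20, 3, -1, -14, -6, 6, 4, 19, -12, -6, 6, 6, -6, 8, -8,
      6, 12]),
     ([12, 47, 5, -22, 0, 0, 12, 0, 0, -21, 2, 17, 0, 47, -21, -8, -6, 8, -12, -27, 31, 15, 6, -7,
      30, -20, 12, 7, -7, -7, 7, -9, 9, -7, -13], [34, -11, -6, 23, 0, 0, 34, 0, 0, -5, 36, -14,
      0, -11, -5, -29, 7, 29, -25, 1, 1, -15, -6, 7, 6, 21, -13, -7, 7, 7, -7, 9, -9, 7, 14]),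
     ([-5, 53, 1, -5, 0, 0, -5, 0, 0, 7, -2, -5, 0, 53, 7, 0, -1, -1, 0, -5, 5, 3, 1, -2, 5, -5,
      3, 2, -2, -2, 2, -2, 2, -2, -3], [28, -10, -7, 28, 0, 0, 28, 0, 0, -39, 11, 29, 0, -10, -39,
      -3, 8, 3, 3, 26, -29, -19, -8, 8, -25, 26, -16, -8, 8, 8, -8, 11, -12, 8, 17]),
     ([35, 39, 11, -45, 0, 0, 35, 0, 0, -4, 39, -17, 0, 39, -4, 1, 39, -1, -1, -16, 15, 27, -22,
      -15, 7, -7, -8, 15, -15, -12, 15, -15, 16, -15, -29], [25, -8, -8, 31, 0, 0, 25, 0, 0, -10,
      23, -4, 0, -8, -10, 1, 24, -1, -1, -2, 5, -18, 33, 11, 12, -12, 22, -11, 11, 7, -11, 10,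
      -10, 11, 22]),
     ([21, 44, 8, -31, 0, 0, 21, 0, 0, -13, 17, 3, 0, 44, -13, -26, -9, 25, 26, -23, 24, 21, 8,
      -9, 20, -28, 18, 9, -9, -9, 9, -12, 13, -9, -18], [22, -8, -8, 34, 0, 0, 22, 0, 0, -15, 18,
      4, 0, -8, -15, -8, 10, 8, 8, -4, 9, -22, -9, 10, 19, 31, -19, -10, 10, 10, -10, 13, -14, 10,
      20]),
     ([21, 44, 8, -31, 0, 0, 21, 0, 0, 3, 26, -16, 0, 44, 3, -1, 25, 1, 1, -16, 11, 38, -24, 27,
      -6, 7, -36, -27, -29, -23, 29, -29, 29, 27, -3], [21, -7, -9, 35, 0, 0, 21, 0, 0, -8, 20,
      -3, 0, -7, -8, 1, 21, -1, -1, -2, 4, -15, -20, 22, 8, -8, 14, -22, 7, 4, -7, 6, -7, 22, 29]),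
     ([7, 49, 4, -17, 0, 0, 7, 0, 0, -25, -6, 25, 0, 49, -25, 2, -5, -2, -2, 27, 35, 11, 5, -5,
      15, -15, 10, 5, -5, -5, 5, -7, 7, -5, -10], [20, -7, -9, 36, 0, 0, 20, 0, 0, -17, 14, 7, 0,
      -7, -17, -3, 10, 4, 3, 4, 11, -24, -10, 11, -33, 33, -21, -11, 11, 11, -11, 14, -15, 11,
      22]),
     ([7, 48, 4, -17, 0, 0, 7, 0, 0, 9, 14, -15, 0, 48, 9, -2, 11, 2, 2, -17, 8, 49, -11, 12, -20,
      21, -23, -12, 12, -35, -12, -42, 42, 12, 24], [17, -6, -10, 38, 0, 0, 17, 0, 0, -6, 17, -3,
      0, -6, -6, 1, 17, 0, -1, -2, 3, -12, -16, 18, 4, -4, -34, -18, 18, 1, -18, 3, -3, 18, 36]),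
     ([-7, 53, 1, -4, 0, 0, -7, 0, 0, 11, -2, -9, 0, 53, 11, 0, -1, 0, 0, -8, 8, 55, 1, -1, 4, -4,
      2, 1, -1, -6, 1, -2, 2, -1, -2], [14, -5, -10, 42, 0, 0, 14, 0, 0, 0, 16, -8, 0, -5, 0, -4,
      12, 4, 4, -13, -2, -4, -11, 13, -38, 39, -24, -13, 13, -45, -13, 17, -17, 13, 25]),
     ([31, 40, 10, -41, 0, 0, 31, 0, 0, -2, 35, -16, 0, 40, -2, 1, 36, 0, -1, -16, 14, 30, -34,
      37, 4, -4, -15, 19, -19, -15, 19, -19, 20, -4, -22], [11, -4, -11, 45, 0, 0, 11, 0, 0, -3,
      11, -3, 0, -4, -3, 0, 10, 0, 0, -3, 2, -7, -10, 11, -2, 2, -6, 4, -4, -5, 4, -4, 3, 52, 48]),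
     ([17, 45, 7, -27, 0, 0, 17, 0, 0, 4, 23, -16, 0, 45, 4, -1, 22, 1, 1, -17, 10, 41, -20, 23,
      -10, 10, -43, -23, 23, -27, 33, -32, 32, 23, 4], [7, -2, -12, 48, 0, 0, 7, 0, 0, -2, 7, -2,
      0, -2, -2, -1, 7, 1, 1, -3, 1, -4, -6, 7, -6, 6, -13, -7, 7, -8, 8, -7, 6, 7, 55]),
     ([4, 50, 3, -14, 0, 0, 4, 0, 0, 11, 10, -15, 0, 50, 11, -3, 8, 3, 3, -17, 7, 52, -7, 8, -24,
      24, -15, -8, 8, -39, -8, 10, 45, 8, 16], [3, -1, -13, 52, 0, 0, 3, 0, 0, 0, 4, -2, 0, -1, 0,
      -1, 3, 1, 1, -3, 0, -1, -3, 3, -9, 10, -6, -3, 3, -11, -3, 4, 9, 3, 6])]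
    [(0, 3), (0, 5), (1, 15), (1, 18), (2, 10), (2, 16), (3, 4), (3, 5), (3, 6), (4, 6), (4, 7),
     (4, 8), (5, 6), (5, 9), (6, 9), (7, 8), (7, 10), (7, 11), (8, 11), (8, 13), (9, 13), (9, 15),
     (10, 12), (10, 16), (11, 13), (11, 14), (12, 14), (12, 16), (12, 17), (13, 15), (14, 17),
     (14, 18), (15, 18), (16, 17), (17, 18)]"
  by code_simp

lemma certificate_40: "certificate 2
    [(0, 0), (380284, 0), (290962, 489344), (20681, 97838), (41363, 195676), (83371, 286425),
     (95071, 31009), (115752, 128847), (125380, 377173), (140957, 204670), (182966, 295418),
     (190142, 62017), (208171, 433259), (215347, 333516), (240552, 213664), (264531, 128847),
     (285213, 31009), (298138, 389602), (305314, 289860), (338921, 195676), (359602, 97838)]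
    [(replicate 39 0, replicate 39 0),
     ([-18, 56, 56, -18, 0, 0, -18, 0, 0, 2, 26, -24, 2, 0, 0, 0, 56, 26, -5, 0, 4, 0, -24, -5,
      26, 56, 0, 0, 0, 4, -3, -25, 0, 26, 0, 0, 0, 5, -18], replicate 39 0),
     ([53, 41, 15, -71, 58, -32, 53, 0, 0, 55, -3, -10, 55, 0, 0, 0, 41, -3, -11, 58, -20, 0, -10,
      -11, 30, 15, 0, 0, 0, -20, 6, -21, 0, 30, 0, 0, -32, -48, -71], [13, -3, -9, 42, 4, 48, 13,
      0, 0, 8, -7, 4, 8, 0, 0, 0, -3, -7, -10, 4, 7, 0, 4, -10, 1, -9, 0, 0, 0, 7, 9, -8, 0, 1, 0,
      0, 48, 46, 42]),
     ([-4, 53, 3, -14, 0, 0, -14, -28, -28, 2, 21, -19, 2, 0, 0, 28, 25, -8, -4, 0, 3, 0, -19, -4,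
      21, 3, 0, 0, 0, 3, -3, -20, 0, 21, 0, 0, 0, 4, -14], [52, -11, -1, 3, 0, 0, 3, 6, 6, 0, -4,
      4, 0, 0, 0, -6, -5, 2, 1, 0, -1, 0, 4, 1, -4, -1, 0, 0, 0, -1, 1, 4, 0, -4, 0, 0, 0, -1, 3]),
     ([10, 50, 6, -28, 0, 0, 10, 0, 0, 4, -15, -38, 4, 0, 0, 0, 50, -15, -8, 0, 7, 0, -38, -8, 41,
      6, 0, 0, 0, 7, -6, -40, 0, 41, 0, 0, 0, 8, -28], [49, -11, -1, 6, 0, 0, 49, 0, 0, -1, 3, 8,
      -1, 0, 0, 0, -11, 3, 2, 0, -1, 0, 8, 2, -9, -1, 0, 0, 0, -1, 1, 8, 0, -9, 0, 0, 0, -2, 6]),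
     ([23, 47, 9, -41, 0, 0, 23, 0, 0, 16, -11, 7, -5, -26, -26, 0, 47, -11, 10, 0, -9, 26, -20,
      -16, 38, 9, 0, 0, 0, -9, 7, -34, 0, 38, 0, 0, 0, -10, -41], [43, -9, -3, 12, 0, 0, 43, 0, 0,
      49, 2, -13, 3, 12, 12, 0, -9, 2, -7, 0, 6, -12, -1, 6, -7, -3, 0, 0, 0, 6, -5, 6, 0, -7, 0,
      0, 0, 6, 12]),
     ([-13, 56, 1, -4, 0, 0, -4, 9, -9, 1, 7, -6, 1, 0, 0, 9, 8, -2, -1, 0, 1, 0, -6, -1, 7, 1, 0,
      0, 0, 1, -1, -6, 0, 7, 0, 0, 0, 1, -4], [41, -9, -3, 14, 0, 0, 14, -27, 27, -2, -20, 19, -2,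
      0, 0, -27, -24, 7, 4, 0, -3, 0, 19, 4, -20, -3, 0, 0, 0, -3, 3, 19, 0, -20, 0, 0, 0, -4,
      14]),
     ([1, 52, 4, -19, 0, 0, -19, -19, 19, 3, 27, -25, 3, 0, 0, 19, 33, -10, -5, 0, 4, 0, -25, -5,
      27, 4, 0, 0, 0, 4, -4, -26, 0, 27, 0, 0, 0, 5, -19], [38, -8, -4, 17, 0, 0, 17, -21, 21, -2,
      -24, 23, -2, 0, 0, 21, -30, 9, 5, 0, -4, 0, 23, 5, -24, -4, 0, 0, 0, -4, 3, 24, 0, -24, 0,
      0, 0, -4, 17]),
     ([37, 45, 12, -54, 0, 0, 37, 0, 0, 34, -8, -1, 34, 0, 0, 0, 45, -8, -24, 0, -24, 0, -1, -24,
      34, 12, 0, 0, 0, -24, 20, -28, 0, 34, 0, 0, 0, -27, -54], [37, -8, -4, 18, 0, 0, 37, 0, 0,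
      40, 0, -9, 40, 0, 0, 0, -8, 0, 9, 0, 13, 0, -9, 9, -5, -4, 0, 0, 0, 13, -10, 3, 0, -5, 0, 0,
      0, 14, 18]),
     ([12, 50, 6, -30, 0, 0, 12, 0, 0, 0, -15, 13, 3, 3, -3, 0, 50, -15, -6, 0, 5, 3, -36, -9, 41,
      6, 0, 0, 0, 5, -4, -39, 0, 41, 0, 0, 0, 6, -30], [35, -8, -4, 20, 0, 0, 35, 0, 0, 37, -1,
      -8, 9, -29, 29, 0, -8, -1, -18, 0, 16, -29, -13, 11, -5, -4, 0, 0, 0, 16, -13, 2, 0, -5, 0,
      0, 0, 17, 20]),
     ([25, 47, 9, -43, 0, 0, 25, 0, 0, 18, -11, 6, -6, -24, 24, 0, 47, -11, 12, 0, -10, 24, -18,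
      -17, 37, 9, 0, 0, 0, -10, 8, -33, 0, 37, 0, 0, 0, -11, -43], [28, -6, -6, 26, 0, 0, 28, 0,
      0, 29, -2, -5, 13, -17, 17, 0, -6, -2, -26, 0, 23, 17, -21, 15, -3, -6, 0, 0, 0, 23, -18,
      -1, 0, -3, 0, 0, 0, 25, 26]),
     ([-9, 55, 2, -9, 0, 0, -9, 0, 0, 1, 13, -12, 1, 0, 0, 0, 55, 13, -2, 0, 2, 0, -12, -2, 13, 2,
      0, 0, 0, 2, -2, -13, 0, 13, 0, 0, 0, 2, -9], [27, -6, -6, 27, 0, 0, 27, 0, 0, -4, -40, 37,
      -4, 0, 0, 0, -6, -40, 8, 0, -7, 0, 37, 8, -40, -6, 0, 0, 0, -7, 5, 39, 0, -40, 0, 0, 0, -7,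
      27]),
     ([45, 43, 14, -63, 0, 0, 45, 0, 0, 45, -6, -5, 45, 0, 0, 0, 43, -6, -18, 41, -6, 0, -5, -18,
      32, 14, -16, -16, 16, -22, 13, -24, 0, 32, 0, 0, -16, -38, -63], [25, -5, -7, 30, 0, 0, 25,
      0, 0, 24, -3, -3, 24, 0, 0, 0, -5, -3, 0, 28, -14, 0, -3, 0, -2, -7, 24, 24, -24, 10, 0, -2,
      0, -2, 0, 0, 24, 30, 30]),
     ([30, 46, 10, -48, 0, 0, 30, 0, 0, 25, -10, 3, 25, 0, 0, 0, 46, -10, -30, 13, 19, 0, 3, -30,
      36, 10, -13, 13, -13, -26, 25, -31, 0, 36, 0, 0, 13, -19, -48], [24, -5, -7, 31, 0, 0, 24,
      0, 0, 23, -4, -2, 23, 0, 0, 0, -5, -4, -1, 26, -12, 0, -2, -1, -2, -7, -26, 26, -26, 9, 0,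
      -3, 0, -2, 0, 0, 26, 32, 31]),
     ([13, 50, 7, -31, 0, 0, 13, 0, 0, 2, -14, 13, 2, 0, 0, 0, 50, -14, -4, 0, 4, 0, 13, -4, 41,
      7, 0, 0, 0, 4, -3, -39, 0, 41, 0, 0, 0, 4, -31], [20, -4, -8, 35, 0, 0, 20, 0, 0, 18, -5, 0,
      18, 0, 0, 0, -4, -5, -38, 0, 33, 0, 0, -38, -1, -8, 0, 0, 0, 33, -26, -5, 0, -1, 0, 0, 0,
      36, 35]),
     ([1, 52, 4, -19, 0, 0, 1, 0, 0, 0, -1, 1, 0, 0, 0, 0, 52, -1, 0, 0, 0, 0, 1, 0, 36, 23, 0, 0,
      0, 0, 0, 1, -19, -1, -19, 19, 0, 0, 1], [17, -4, -8, 38, 0, 0, 17, 0, 0, -2, -24, 23, -2, 0,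
      0, 0, -4, -24, 5, 0, -4, 0, 23, 5, 9, -30, 0, 0, 0, -4, 3, 24, 21, -24, 21, -21, 0, -4, 17]),
     ([-13, 56, 1, -4, 0, 0, -13, 0, 0, 2, 20, -18, 2, 0, 0, 0, 56, 20, -4, 0, 3, 0, -18, -4, 29,
      49, 0, 0, 0, 3, -3, -19, -9, 20, 9, -9, 0, 4, -13], [14, -3, -9, 41, 0, 0, 14, 0, 0, -2,
      -20, 19, -2, 0, 0, 0, -3, -20, 4, 0, -3, 0, 19, 4, 7, -24, 0, 0, 0, -3, 3, 19, -27, -20, 27,
      -27, 0, -4, 14]),
     ([38, 44, 12, -56, 0, 0, 38, 0, 0, 36, -7, -2, 36, 0, 0, 0, 44, -7, -23, 29, 5, 0, -2, -23,
      34, 12, -29, 29, 29, -24, 18, -27, 0, 34, 0, 0, -4, -29, -56], [12, -3, -9, 43, 0, 0, 12, 0,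
      0, 7, -7, 5, 7, 0, 0, 0, -3, -7, -11, 2, 8, 0, 5, -11, 2, -9, -2, 2, 2, 6, 10, -8, 0, 2, 0,
      0, 50, 47, 43]),
     ([24, 47, 9, -42, 0, 0, 24, 0, 0, 17, -11, 6, 17, 0, 0, 0, 47, -11, -35, 0, 30, 0, 6, -35,
      38, 9, 0, 0, 0, 30, 30, -34, 0, 38, 0, 0, 0, -10, -42], [11, -2, -10, 44, 0, 0, 11, 0, 0, 6,
      -7, 5, 6, 0, 0, 0, -2, -7, -12, 0, 10, 0, 5, -12, 2, -10, 0, 0, 0, 10, 11, -9, 0, 2, 0, 0,
      0, 49, 44]),
     ([10, 50, 6, -28, 0, 0, 10, 0, 0, -1, -15, 14, -1, 0, 0, 0, 50, -15, 3, 0, -2, 0, 14, 3, 41,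
      6, 0, 0, 0, -2, 2, 15, 0, 41, 0, 0, 0, -3, -28], [6, -1, -11, 49, 0, 0, 6, 0, 0, -1, -9, 8,
      -1, 0, 0, 0, -1, -9, 2, 0, -1, 0, 8, 2, 3, -11, 0, 0, 0, -1, 1, 8, 0, 3, 0, 0, 0, -2, 49]),
     ([-4, 53, 3, -14, 0, 0, -4, 0, 0, 1, 6, -5, 1, 0, 0, 0, 53, 6, -1, 0, 1, 0, -5, -1, 34, 31,
      0, 0, 0, 1, -1, -5, -28, 6, 28, 28, 0, 1, -4], [3, -1, -11, 52, 0, 0, 3, 0, 0, 0, -4, 4, 0,
      0, 0, 0, -1, -4, 1, 0, -1, 0, 4, 1, 2, -5, 0, 0, 0, -1, 1, 4, -6, -4, 6, 6, 0, -1, 3])]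
    [(0, 3), (0, 6), (1, 16), (1, 20), (2, 12), (2, 17), (3, 4), (3, 6), (3, 7), (4, 5), (4, 7),
     (4, 9), (5, 8), (5, 9), (5, 10), (6, 7), (6, 11), (7, 11), (8, 10), (8, 12), (8, 13), (9,
     10), (9, 14), (10, 14), (11, 15), (11, 16), (12, 13), (12, 17), (13, 17), (13, 18), (14, 18),
     (14, 19), (15, 16), (15, 19), (15, 20), (16, 20), (17, 18), (18, 19), (19, 20)]"
  by code_simp

text \<open>The third half with \<open>m = 3\<close>; its 22 vertices give
  \<open>2 * 22 - 3 = 41\<close>.\<close>

lemma certificate_41: "certificate 3
    [(0, 0), (202089, 0), (395802, 0), (255635, 323075), (2102, 99978), (4205, 199956), (80050,
     265128), (87635, 48168), (89737, 148146), (98569, 166858), (155896, 330301), (174414,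
     232030), (175269, 96336), (194692, 194432), (221511, 98096), (250260, 297203), (293872,
     207214), (307561, 149042), (308657, 49048), (349998, 289977), (393610, 199988), (394706,
     99994)]
    [(replicate 40 0, replicate 40 0),
     ([2, 57, 83, -142, 0, 31, 0, 0, 2, 0, 0, 0, -7, 6, 0, 0, 0, 0, 57, -7, -8, 12, 0, 0, -8, 113,
      -110, 63, -66, 0, 6, -8, 8, 61, 0, -66, 0, 0, -8, 31], replicate 40 0),
     ([44, 56, -62, -86, 57, 46, 0, 0, 44, 0, 0, 30, -76, 45, -15, 15, 15, 0, 56, -76, -27, 63,
      -15, 15, -12, 6, -15, 66, -82, 57, 14, -1, 1, 71, 0, -82, 0, 0, -1, 46], replicate 40 0),
     ([49, 56, -31, -42, 0, -5, 63, 14, 49, 0, 0, 39, -60, 24, -10, 29, 10, 0, 56, -60, -10, 30,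
      -10, -41, 0, 29, -33, 43, -20, 0, -13, -34, 23, 25, 0, -20, 0, 0, -18, -5], [18, 0, 0, 0, 0,
      32, 180, 190, 18, 0, 0, 20, 0, -16, 17, 37, -17, 0, 0, 0, -20, 4, 17, -164, -37, 0, 0, 3, 0,
      0, -19, -175, 20, -16, 0, 0, 0, 0, 37, 32]),
     ([1, 57, -14, -20, 0, 4, 0, 0, 0, -29, -29, 0, -1, 1, 0, 0, 0, 29, 28, -30, -1, 2, 0, 0, -1,
      16, -15, 9, -9, 0, 1, -1, 1, 8, 0, -9, 0, 0, -1, 4], [50, -1, 0, 0, 0, 0, 0, 0, 0, 1, 1, 0,
      0, 0, 0, 0, 0, -1, -1, 1, 0, 0, 0, 0, 0, 0, 0, 0, 0, 0, 0, 0, 0, 0, 0, 0, 0, 0, 0, 0]),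
     ([30, 56, -28, -39, 0, 8, 0, 0, 30, 0, 0, 0, -60, 2, 0, 0, 0, 0, 56, -60, -2, 3, 0, 0, -2,
      31, -30, 17, -18, 0, 2, -2, 2, 17, 0, -18, 0, 0, -2, 8], [49, -1, 1, 1, 0, 0, 0, 0, 49, 0,
      0, 0, 1, 0, 0, 0, 0, 0, -1, 1, 0, 0, 0, 0, 0, -1, 1, 0, 0, 0, 0, 0, 0, 0, 0, 0, 0, 0, 0, 0]),
     ([40, 56, -29, -41, 0, 1, 0, 0, 40, 0, 0, 29, -60, 31, -24, -14, -14, 0, 56, -60, 14, 15, 14,
      -14, 0, 30, -31, 29, -19, 0, -4, -11, 11, 21, 0, -19, 0, 0, -11, 1], [38, -1, 2, 2, 0, 8, 0,
      0, 38, 0, 0, 42, 2, -35, 28, 16, 16, 0, -1, 2, -18, -14, -16, 16, -3, 0, 2, -14, 1, 0, 7,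
      10, -10, -5, 0, 1, 0, 0, 10, 8]),
     ([-14, 57, -7, -9, 0, 2, 0, 0, 0, 14, -14, 0, 0, 0, 0, 0, 0, 14, 14, -14, -1, 1, 0, 0, -1, 8,
      -7, 4, -4, 0, 0, -1, 1, 4, 0, -4, 0, 0, -1, 2], [25, -1, 12, 17, 0, -4, 0, 0, 0, -25, 25, 0,
      1, -1, 0, 0, 0, -25, -25, 26, 1, -1, 0, 0, 1, -14, 13, -8, 8, 0, -1, 1, -1, -7, 0, 8, 0, 0,
      1, -4]),
     ([15, 57, -21, -29, 0, 6, 0, 0, 0, -15, 15, 0, -1, 1, 0, 0, 0, 15, 42, -44, -2, 2, 0, 0, -2,
      23, -23, 13, -13, 0, 1, -2, 2, 12, 0, -13, 0, 0, -2, 6], [24, -1, 13, 18, 0, -4, 0, 0, 0,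
      -25, 25, 0, 1, -1, 0, 0, 0, 25, -25, 27, 1, -1, 0, 0, 1, -14, 14, -8, 8, 0, -1, 1, -1, -8,
      0, 8, 0, 0, 1, -4]),
     ([26, 56, -28, -39, 0, 12, 0, 0, 26, 0, 0, 14, -59, 43, -7, 7, 7, 0, 56, -59, -10, -3, -7, 7,
      -3, 32, -30, 11, -18, 0, 5, 2, -2, 15, 0, -18, 0, 0, 2, 12], [36, -1, 2, 3, 0, 10, 0, 0, 36,
      0, 0, 40, 2, -33, -20, 20, 20, 0, -1, 2, -23, -18, -20, 20, -3, 1, 2, -17, 1, 0, 9, 13, -13,
      -7, 0, 1, 0, 0, 13, 10]),
     ([49, 56, -30, -42, 0, -6, 0, 0, 49, 0, 0, 40, -60, 24, -10, 29, 10, 0, 56, -60, -8, 27, -10,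
      -27, 2, 29, -32, 41, -20, 0, -10, -20, 20, 25, 0, -20, 0, 0, -20, -6], [27, -1, 3, 4, 0, 16,
      0, 0, 27, 0, 0, 30, 2, -26, 12, 42, -12, 0, -1, 2, 7, -28, 12, 32, -5, 1, 3, -28, 2, 0, 14,
      20, -20, -10, 0, 2, 0, 0, 20, 16]),
     ([35, 56, -29, -40, 0, 5, 0, 0, 35, 0, 0, 24, -60, 35, -31, -7, 31, 0, 56, -60, 25, 9, 7, -7,
      -1, 31, -31, 23, -19, 0, -1, -7, 7, 19, 0, -19, 0, 0, -7, 5], [25, -1, 3, 4, 0, 18, 0, 0,
      25, 0, 0, 28, 2, -23, 8, 36, -8, 0, -1, 2, 13, -32, -36, 36, -6, 2, 3, -31, 2, 0, 15, 23,
      -23, -12, 0, 2, 0, 0, 23, 18]),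
     ([0, 57, -14, -19, 0, 4, 0, 0, 0, 0, 0, 0, -1, 1, 0, 0, 0, 0, 57, -1, -1, 2, 0, 0, -1, 15,
      -15, 8, -9, 0, 1, -1, 1, 8, 0, -9, 0, 0, -1, 4], [0, 0, 25, 34, 0, -7, 0, 0, 0, 0, 0, 0, 2,
      -1, 0, 0, 0, 0, 0, 2, 2, -3, 0, 0, 2, -27, 27, -15, 16, 0, -2, 2, -2, -15, 0, 16, 0, 0, 2,
      -7]),
     ([38, 56, -36, -49, 0, 18, 0, 0, 38, 0, 0, 27, -63, 36, -13, 13, 13, 0, 56, -63, -18, 47,
      -13, 13, -5, 26, -38, 11, -23, 0, 8, 5, -5, 18, 0, -23, 0, 0, 5, 18], [-8, 0, 29, 40, 0,
      -10, 0, 0, -8, 0, 0, -5, 14, -8, 3, -3, -3, 0, 0, 14, 5, -12, 3, -3, 3, 22, 31, -16, 19, 0,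
      -3, 1, -1, -17, 0, 19, 0, 0, 1, -10]),
     ([40, 56, -48, -66, -1, 44, 0, 0, 40, 0, 0, 27, -69, 41, -14, 14, 14, 0, 56, -69, -25, 58,
      -14, 14, -11, 17, -25, 66, -80, -1, 13, -2, 2, 70, 0, -80, 0, 0, -2, 44], [-7, 0, 26, 36, 0,
      -3, 0, 0, -7, 0, 0, -5, 12, -7, 3, -3, -3, 0, 0, 12, 3, -9, 3, -3, 1, 19, -17, -1, 3, 0, -1,
      -1, 1, -2, 0, 3, 0, 0, -1, -3]),
     ([44, 56, -30, -41, 0, -2, 0, 0, 44, 0, 0, 35, -60, 28, -17, 17, 17, 0, 56, -60, 3, 21, -17,
      17, 20, 30, -32, 35, -19, 0, -7, -15, 15, 23, 0, -19, 0, 0, -15, -2], [14, 0, 4, 6, 0, 27,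
      0, 0, 14, 0, 0, 16, 2, -14, -8, 8, 8, 0, 0, 2, 38, -46, -8, 8, 46, 3, 4, -45, 3, 0, 22, 33,
      -33, -17, 0, 3, 0, 0, 33, 27]),
     ([36, 56, -32, -45, 0, 12, 0, 0, 36, 0, 0, 25, -61, 36, -12, 12, 12, 0, 56, -61, -21, 50,
      -12, 12, -9, 28, -35, 63, -21, 0, 11, 0, 0, 18, 0, -21, 0, 0, 0, 12], [9, 0, 3, 4, 0, 34, 0,
      0, 9, 0, 0, 11, 2, -10, -5, 5, 5, 0, 0, 2, 27, -32, -5, 5, 32, 2, 3, -31, 2, 0, -25, 40,
      -40, -19, 0, 2, 0, 0, 40, 34]),
     ([37, 56, -40, -55, 0, 29, 0, 0, 37, 0, 0, 26, -65, 39, -13, 13, 13, 0, 56, -65, -24, 55,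
      -13, 13, -11, 22, -30, 66, -36, 14, 13, -2, 2, 70, -15, -79, -15, 15, -2, 44], [-4, 0, 13,
      18, 0, 23, 0, 0, -4, 0, 0, -3, 6, -4, 1, -1, -1, 0, 0, 6, 2, -5, 1, -1, 0, 10, -9, 0, 27,
      -25, -1, -1, 1, -1, 25, 1, 25, -25, -1, -1]),
     ([42, 56, -55, -76, -1, 59, 0, 0, 42, 0, 0, 29, -72, 43, -14, 14, 14, 0, 56, -72, -26, 60,
      -14, 14, -12, 12, -20, 66, -67, 43, 14, -1, 1, 71, -14, -81, 14, -14, -1, 45], [-4, 0, 13,
      18, 0, 24, 0, 0, -4, 0, 0, -3, 6, -4, 1, -1, -1, 0, 0, 6, 2, -5, 1, -1, 0, 10, -8, 0, 27,
      -25, -1, -1, 1, -1, -25, 1, 25, -25, -1, -1]),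
     ([44, 56, -30, -42, 0, -1, 0, 0, 44, 0, 0, 34, -60, 28, -17, 17, 17, 0, 56, -60, 1, 24, -17,
      17, 18, 30, -32, 37, -19, 0, -10, 34, 18, 23, 0, -19, 0, 0, -14, -1], [4, 0, 2, 2, -1, 43,
      0, 0, 4, 0, 0, 5, 1, -4, -2, 2, 2, 0, 0, 1, 12, -14, -2, 2, 14, 1, 1, -14, 1, -1, -11, 18,
      8, -23, 0, 1, 0, 0, 50, 43]),
     ([35, 56, -33, -45, 0, 13, 0, 0, 35, 0, 0, 24, -61, 37, -12, 12, 12, 0, 56, -61, -23, 52,
      -12, 12, -11, 28, -35, 66, -21, 0, 13, -3, 3, 69, 0, -21, 0, 0, -3, 13], [0, 0, 0, 0, -1,
      50, 0, 0, 0, 0, 0, 0, 0, 0, 0, 0, 0, 0, 0, 0, 0, 0, 0, 0, 0, 0, 0, 0, 1, -1, 0, 0, 0, 0, 0,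
      1, 0, 0, 0, 50]),
     ([39, 56, -47, -66, -1, 44, 0, 0, 39, 0, 0, 27, -68, 41, -14, 14, 14, 0, 56, -68, -25, 58,
      -14, 14, -11, 17, -25, 66, -51, 28, 13, -2, 2, 70, -29, -80, 29, 29, -2, 44], [0, 0, 0, 0,
      -1, 50, 0, 0, 0, 0, 0, 0, 0, 0, 0, 0, 0, 0, 0, 0, 0, 0, 0, 0, 0, 0, 0, 0, 0, 0, 0, 0, 0, 0,
      0, 0, 0, 0, 0, 0])]
    [(0, 4), (0, 7), (1, 12), (1, 14), (2, 18), (2, 21), (3, 10), (3, 19), (4, 5), (4, 7), (4, 8),
     (5, 6), (5, 8), (5, 9), (6, 9), (6, 10), (6, 11), (7, 8), (7, 12), (8, 12), (9, 11), (9, 13),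
     (10, 11), (10, 15), (11, 15), (12, 13), (13, 14), (13, 16), (14, 17), (14, 18), (15, 16),
     (15, 19), (16, 19), (16, 20), (17, 18), (17, 20), (17, 21), (18, 21), (19, 20), (20, 21)]"
  by code_simp

theorem theorem3:
  shows "\<forall>n::nat \<in> {22, 30, 31, 34, 35, 36, 40, 41}.
           \<exists>V E. matchstick_graph V E \<and> regular_2_4 V E \<and> card V = n \<and>
                 card {v \<in> V. degree E v = 2} = 2"
proof -
  let ?G = "\<lambda>n. \<exists>V E. matchstick_graph V E \<and> regular_2_4 V E \<and> card V = n \<and>
    card {v \<in> V. degree E v = 2} = 2"
  \<comment> \<open>The numeral type \<open>21\<close> has 21 elements, one per edge of the half,
    and \<open>2 * 12 - 2 = 22\<close>. The other orders arise in the same way.\<close>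
  have "?G 22"
    using certificate_imp_graph[OF certificate_22, where 'n = 21] by simp
  moreover have "?G 30"
    using certificate_imp_graph[OF certificate_30, where 'n = 29] by simp
  moreover have "?G 31"
    using certificate_imp_graph[OF certificate_31, where 'n = 30] by simp
  moreover have "?G 34"
    using certificate_imp_graph[OF certificate_34, where 'n = 33] by simp
  moreover have "?G 35"
    using certificate_imp_graph[OF certificate_35, where 'n = 34] by simp
  moreover have "?G 36"
    using certificate_imp_graph[OF certificate_36, where 'n = 35] by simp
  moreover have "?G 40"
    using certificate_imp_graph[OF certificate_40, where 'n = 39] by simp
  moreover have "?G 41"
    using certificate_imp_graph[OF certificate_41, where 'n = 40] by simp
  ultimately show ?thesis
    by simp
qed

end
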